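(* For real $s\ge 2$ let $b_s(\cos\theta)=2^{4/(s-1)}\,\dfrac{\beta_s(\theta)}{\sin\theta}\,|\beta_s'(\theta)|$, $\theta\in(0,\pi]$, be the angular part of the Boltzmann collision kernel for the inverse power law potential $U_s(r)=r^{-(s-1)}$, where $\beta_s(\theta)$ is the rescaled impact parameter as a function of the deviation angle $\theta$ (as defined in the context). Then: (i) As $s\to\infty$, $b_s(\cos\theta)\to \dfrac14$ locally uniformly for $\theta\in(0,\pi]$ (i.e. uniformly on compact subsets of $(0,\pi]$). (ii) For every $s\ge 2$, $$\lim_{\theta\to0^+}\theta^{1+2/(s-1)}\,b_s(\cos\theta)\sin\theta = C_s,\qquad C_s:=\frac{2^{4/(s-1)}}{s-1}\left(\frac{\sqrt{\pi}\,\Gamma\left(\frac{s}{2}\right)}{\Gamma\left(\frac{s-1}{2}\right)}\right)^{2/(s-1)},$$ where $\Gamma$ is the Gamma function. (iii) One has the uniform bound $$\sup_{s\ge3}\ \sup_{\theta\in(0,\pi]}\ \theta^{1+2/(s-1)}\,b_s(\cos\theta)\sin\theta<\infty .$$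
   Context: Definition of $\beta_s(\theta)$. Fix $s\ge2$. For $\beta>0$ let $x_0=x_0(\beta)\in(0,1)$ be the positive root of $1-x^2-(x/\beta)^{s-1}=0$, and set $$\varphi_0(\beta)=\int_0^{x_0(\beta)}\frac{dy}{\sqrt{1-y^2-(y/\beta)^{s-1}}},\qquad \theta(\beta)=\pi-2\varphi_0(\beta).$$ Equivalently, substituting $y=x_0z$, one has $\varphi_0=\varphi_s(x_0)$ with $$\varphi_s(x)=x\int_0^1\frac{dz}{\sqrt{1-z^{s-1}-x^2(z^2-z^{s-1})}},\qquad x\in[0,1),$$ and $\beta=x_0(1-x_0^2)^{-1/(s-1)}$. With $x_0(0)=0$, the maps $\beta\mapsto x_0(\beta)$ and $x\mapsto\varphi_s(x)$ are strictly increasing bijections $[0,\infty)\to[0,1)$ and $[0,1)\to[0,\pi/2)$. Hence $\beta\mapsto\theta(\beta)$ is a strictly decreasing bijection from $[0,\infty)$ onto $(0,\pi]$; its inverse is denoted $\theta\mapsto\beta_s(\theta)$, and $\beta_s'$ is its derivative with respect to $\theta$. At $\theta=\pi$ (where $\beta_s(\pi)=0$ and $\sin\pi=0$) the value $b_s(\cos\theta)$ is understood as the continuous extension from $\theta<\pi$. *)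

theory Defs
  imports "HOL-Analysis.Analysis"
begin

text \<open>Since \<open>s \<ge> 2\<close> is real, \<open>(y / \<beta>)\<close> is raised to a real exponent by \<open>powr\<close>; its base is
  nonnegative throughout.\<close>

definition turning_point :: "real \<Rightarrow> real \<Rightarrow> real" where
  "turning_point s \<beta> =
     (if \<beta> = 0 then 0
      else (THE x. 0 < x \<and> x < 1 \<and> 1 - x\<^sup>2 - (x / \<beta>) powr (s - 1) = 0))"

text \<open>The integrand is singular at the upper end point. The integral is a Lebesgue integral, which
  for a nonnegative integrand agrees with the improper Riemann integral.\<close>

definition apsidal_angle :: "real \<Rightarrow> real \<Rightarrow> real" where
  "apsidal_angle s \<beta> =
     (LBINT y:{0..turning_point s \<beta>}. 1 / sqrt (1 - y\<^sup>2 - (y / \<beta>) powr (s - 1)))"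

definition deviation_angle :: "real \<Rightarrow> real \<Rightarrow> real" where
  "deviation_angle s \<beta> = pi - 2 * apsidal_angle s \<beta>"

definition impact_parameter :: "real \<Rightarrow> real \<Rightarrow> real" where
  "impact_parameter s = the_inv_into {0..} (deviation_angle s)"

definition kernel_formula :: "real \<Rightarrow> real \<Rightarrow> real" where
  "kernel_formula s \<theta> =
     2 powr (4 / (s - 1)) * (impact_parameter s \<theta> / sin \<theta>) * \<bar>deriv (impact_parameter s) \<theta>\<bar>"

text \<open>The kernel as a function of \<open>u = cos \<theta>\<close>. The head-on collision \<open>u = - 1\<close>, i.e. \<open>\<theta> = \<pi>\<close>, where
  the formula reads \<open>0 / 0\<close>, gets its value by continuous extension from \<open>\<theta> < \<pi>\<close>.\<close>

definition angular_kernel :: "real \<Rightarrow> real \<Rightarrow> real" where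
  "angular_kernel s u =
     (if u = - 1 then Lim (at_left pi) (kernel_formula s) else kernel_formula s (arccos u))"

definition grazing_constant :: "real \<Rightarrow> real" where
  "grazing_constant s =
     2 powr (4 / (s - 1)) / (s - 1) *
     (sqrt pi * Gamma (s / 2) / Gamma ((s - 1) / 2)) powr (2 / (s - 1))"

end

theory Submission
  imports Defs "HOL-Real_Asymp.Real_Asymp"
begin

text \<open>
  Write \<open>p = s - 1\<close>. Everything is expressed through the turning point \<open>x \<in> (0,1)\<close> instead of
  \<open>\<theta>\<close> or \<open>\<beta>\<close>. With \<open>D(x,z) = x\<^sup>2(1 - z\<^sup>2) + (1 - x\<^sup>2)(1 - z\<^sup>p)\<close> the apsidal angle is
  \<open>F(x) = \<integral>\<^sub>0\<^sup>1 x D\<^sup>-\<^sup>1\<^sup>/\<^sup>2 dz\<close>. As \<open>D\<close> is a convex combination of two functions that are at least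
  \<open>1 - z\<close>, the only singularity is the one of \<open>(1 - z)\<^sup>-\<^sup>1\<^sup>/\<^sup>2\<close>, uniformly for \<open>x \<in> [0,1]\<close>, and one may
  differentiate under the integral up to both end points. The derivative collapses to the positive
  expression \<open>G(x) = \<integral>\<^sub>0\<^sup>1 (1 - z\<^sup>p) D\<^sup>-\<^sup>3\<^sup>/\<^sup>2 dz\<close>, and \<open>1/2 \<le> G \<le> 2p\<close>
  (\<open>swept_angle_deriv\<close>, \<open>swept_rate_bounds\<close>). So \<open>F\<close> is a diffeomorphism of \<open>[0,1]\<close> onto
  \<open>[0,\<pi>/2]\<close>. Since \<open>\<beta> = x (1 - x\<^sup>2)\<^sup>-\<^sup>1\<^sup>/\<^sup>p\<close> and \<open>\<theta> = \<pi> - 2 F(x)\<close>, the inverse function theorem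
  gives, with \<open>t = 1 - x\<^sup>2\<close>, the closed form (\<open>kernel_formula_swept_angle\<close>)
  \<open>b sin \<theta> = 2\<^sup>4\<^sup>/\<^sup>p x t\<^sup>-\<^sup>2\<^sup>/\<^sup>p (1 + 2x\<^sup>2/(pt)) / (2 G(x))\<close>.

  Multiplied by \<open>\<theta>\<^sup>1\<^sup>+\<^sup>2\<^sup>/\<^sup>p\<close> this depends on \<open>\<theta>\<close> mainly through the ratio \<open>\<theta>/t\<close>. The bounds on \<open>G\<close> give
  \<open>\<theta>/t \<le> 4p\<close>, and \<open>(4p)\<^sup>2\<^sup>/\<^sup>p\<close> stays bounded: this is the uniform bound. As \<open>x \<rightarrow> 1\<close> the ratio tends to
  \<open>G(1)\<close>, which a partial integration turns into a Beta integral: this is the grazing limit.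

  For \<open>p \<rightarrow> \<infinity>\<close> the radicand becomes that of rigid spheres, \<open>1 - x\<^sup>2z\<^sup>2\<close>, for which \<open>F\<close> is \<open>arcsin\<close>. The
  errors in \<open>F\<close> and \<open>G\<close> are controlled by the single quantity \<open>\<integral>\<^sub>0\<^sup>1 z\<^sup>p (1 - z)\<^sup>-\<^sup>1\<^sup>/\<^sup>2 dz\<close>, which
  tends to \<open>0\<close> (\<open>swept_angle_vs_arcsin\<close>, \<open>swept_rate_vs_arcsin_rate\<close>). The kernel is \<open>1/4\<close> times six
  factors, each of which is squeezed to \<open>1\<close> uniformly as long as \<open>\<theta>\<close> stays away from \<open>0\<close>; the value
  at \<open>\<theta> = \<pi>\<close> inherits the same bounds because it is a limit of values that satisfy them.
\<close>

section \<open>Integrals depending on a parameter and integrals over the unit interval\<close>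

lemma set_integrable_dominated:
  fixes f w :: "'a \<Rightarrow> real"
  assumes "A \<in> sets M" "f \<in> borel_measurable M" "set_integrable M A w"
    and "\<And>z. z \<in> A \<Longrightarrow> \<bar>f z\<bar> \<le> w z"
  shows "set_integrable M A f"
proof (rule set_integrable_bound[OF assms(3)])
  show "set_borel_measurable M A f"
    unfolding set_borel_measurable_def using assms(1,2) by measurable
  show "AE z in M. z \<in> A \<longrightarrow> norm (f z) \<le> norm (w z)"
    using assms(4) by (auto intro!: AE_I2 order_trans[OF _ abs_ge_self])
qed

lemma continuous_on_set_LINT:
  fixes g :: "real \<Rightarrow> 'a \<Rightarrow> real"
  assumes A: "A \<in> sets M"
    and meas: "\<And>u. u \<in> U \<Longrightarrow> g u \<in> borel_measurable M"
    and cont: "\<And>z. z \<in> A \<Longrightarrow> continuous_on U (\<lambda>u. g u z)"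
    and bound: "\<And>u z. u \<in> U \<Longrightarrow> z \<in> A \<Longrightarrow> \<bar>g u z\<bar> \<le> w z"
    and w: "set_integrable M A w"
  shows "continuous_on U (\<lambda>u. LINT z:A|M. g u z)"
  unfolding continuous_on_sequentially
proof (intro allI ballI impI)
  fix X x assume x: "x \<in> U" and X: "(\<forall>n::nat. X n \<in> U) \<and> X \<longlonglongrightarrow> x"
  show "((\<lambda>u. LINT z:A|M. g u z) \<circ> X) \<longlonglongrightarrow> (LINT z:A|M. g x z)"
    unfolding set_lebesgue_integral_def o_def
  proof (rule integral_dominated_convergence[where w = "\<lambda>z. indicator A z *\<^sub>R w z"])
    show "AE z in M. (\<lambda>n. indicator A z *\<^sub>R g (X n) z) \<longlonglongrightarrow> indicator A z *\<^sub>R g x z"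
    proof (intro AE_I2)
      fix z
      have "z \<in> A \<Longrightarrow> (\<lambda>n. g (X n) z) \<longlonglongrightarrow> g x z"
        using cont[of z] x X unfolding continuous_on_sequentially o_def by blast
      then show "(\<lambda>n. indicator A z *\<^sub>R g (X n) z) \<longlonglongrightarrow> indicator A z *\<^sub>R g x z"
        by (auto simp: indicator_def)
    qed
    show "AE z in M. norm (indicator A z *\<^sub>R g (X n) z) \<le> indicator A z *\<^sub>R w z" for n
      using bound X by (auto simp: indicator_def)
  qed (use meas x X A w in \<open>auto simp: set_integrable_def intro!: borel_measurable_scaleR\<close>)
qed

text \<open>By the mean value theorem on the convex set \<open>U\<close> the difference quotients obey the same bound \<open>w\<close> as
  the derivatives, so dominated convergence applies. Working within \<open>U\<close> allows one-sided derivatives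
  at the end points of an interval, where the grazing and the head-on limits are taken.\<close>

lemma has_real_derivative_set_LINT:
  fixes f f' :: "real \<Rightarrow> 'a \<Rightarrow> real"
  assumes A: "A \<in> sets M" and U: "convex U" "x \<in> U"
    and integ: "\<And>u. u \<in> U \<Longrightarrow> set_integrable M A (f u)"
    and meas: "f' x \<in> borel_measurable M"
    and deriv: "\<And>u z. u \<in> U \<Longrightarrow> z \<in> A \<Longrightarrow>
                  ((\<lambda>u. f u z) has_real_derivative f' u z) (at u within U)"
    and bound: "\<And>u z. u \<in> U \<Longrightarrow> z \<in> A \<Longrightarrow> \<bar>f' u z\<bar> \<le> w z"
    and w: "set_integrable M A w"
  shows "((\<lambda>u. LINT z:A|M. f u z) has_real_derivative (LINT z:A|M. f' x z)) (at x within U)"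
  unfolding has_field_derivative_iff tendsto_at_iff_sequentially
proof (intro allI impI)
  fix X :: "nat \<Rightarrow> real"
  assume X: "\<forall>i. X i \<in> U - {x}" "X \<longlonglongrightarrow> x"
  have quot: "((LINT z:A|M. f (X n) z) - (LINT z:A|M. f x z)) / (X n - x)
      = (LINT z:A|M. (f (X n) z - f x z) / (X n - x))" for n
    using integ X U by (simp add: set_integral_diff)
  have qint: "set_integrable M A (\<lambda>z. (f (X n) z - f x z) / (X n - x))" for n
    using integ X U by (intro set_integrable_divide set_integral_diff) auto
  have "(\<lambda>n. LINT z:A|M. (f (X n) z - f x z) / (X n - x)) \<longlonglongrightarrow> (LINT z:A|M. f' x z)"
    unfolding set_lebesgue_integral_def
  proof (rule integral_dominated_convergence[where w = "\<lambda>z. indicator A z *\<^sub>R w z"])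
    show "AE z in M. (\<lambda>n. indicator A z *\<^sub>R ((f (X n) z - f x z) / (X n - x)))
            \<longlonglongrightarrow> indicator A z *\<^sub>R f' x z"
    proof (intro AE_I2)
      fix z
      have "(\<lambda>n. (f (X n) z - f x z) / (X n - x)) \<longlonglongrightarrow> f' x z" if "z \<in> A"
        using deriv[OF U(2) that] X
        unfolding has_field_derivative_iff tendsto_at_iff_sequentially o_def by blast
      then show "(\<lambda>n. indicator A z *\<^sub>R ((f (X n) z - f x z) / (X n - x)))
            \<longlonglongrightarrow> indicator A z *\<^sub>R f' x z"
        by (auto simp: indicator_def)
    qed
    show "AE z in M. norm (indicator A z *\<^sub>R ((f (X n) z - f x z) / (X n - x)))
            \<le> indicator A z *\<^sub>R w z" for n
    proof (intro AE_I2)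
      fix z
      have "norm ((f (X n) z - f x z) / (X n - x)) \<le> w z" if "z \<in> A"
      proof -
        have "norm (f (X n) z - f x z) \<le> w z * norm (X n - x)"
          using U X that bound
          by (intro field_differentiable_bound[of U "\<lambda>u. f u z" "\<lambda>u. f' u z"] deriv) auto
        moreover have "norm (X n - x) > 0" using X by auto
        ultimately show ?thesis by (simp add: norm_divide divide_le_eq)
      qed
      then show "norm (indicator A z *\<^sub>R ((f (X n) z - f x z) / (X n - x)))
            \<le> indicator A z *\<^sub>R w z"
        by (auto simp: indicator_def)
    qed
  qed (use qint w meas A in \<open>auto simp: set_integrable_def intro!: borel_measurable_scaleR\<close>)
  then show "((\<lambda>y. ((LINT z:A|M. f y z) - (LINT z:A|M. f x z)) / (y - x)) \<circ> X)
      \<longlonglongrightarrow> (LINT z:A|M. f' x z)"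
    by (simp add: o_def quot)
qed

text \<open>The integrand may be singular at both end points. A nonnegative one is then integrable
  automatically; otherwise its integrability has to be known.\<close>

lemma unit_interval_FTC:
  fixes h H :: "real \<Rightarrow> real"
  assumes deriv: "\<And>z. z \<in> {0<..<1} \<Longrightarrow> (H has_real_derivative h z) (at z)"
    and cont: "continuous_on {0<..<1} h"
    and integ: "set_integrable lborel {0<..<1} h \<or> (\<forall>z\<in>{0<..<1}. 0 \<le> h z)"
    and lim: "(H \<longlongrightarrow> a) (at_right 0)" "(H \<longlongrightarrow> b) (at_left 1)"
  shows "set_integrable lborel {0<..<1} h" "(LBINT z:{0<..<1}. h z) = b - a"
proof -
  have isCont: "isCont h z" if "0 < z" "z < 1" for z
    using cont that by (simp add: continuous_on_eq_continuous_at)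
  have lim': "((H \<circ> real_of_ereal) \<longlongrightarrow> a) (at_right (ereal 0))"
    "((H \<circ> real_of_ereal) \<longlongrightarrow> b) (at_left (ereal 1))"
    using lim by (simp_all add: ereal_tendsto_simps)
  have int: "set_integrable lborel {0<..<1} h"
    using integ
  proof
    assume "\<forall>z\<in>{0<..<1}. 0 \<le> h z"
    then show ?thesis
      using interval_integral_FTC_nonneg(1)[of "ereal 0" "ereal 1" H h a b] deriv isCont lim'
      by auto
  qed
  have "(LBINT z=ereal 0..ereal 1. h z) = b - a"
    using interval_integral_FTC_integrable[of "ereal 0" "ereal 1" H h a b] deriv isCont lim' int
    by (auto simp: has_real_derivative_iff_has_vector_derivative)
  then show "(LBINT z:{0<..<1}. h z) = b - a"
    by (simp add: interval_lebesgue_integral_def)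
  show "set_integrable lborel {0<..<1} h" by (rule int)
qed

lemma unit_interval_FTC_closed:
  fixes h H :: "real \<Rightarrow> real"
  assumes deriv: "\<And>z. z \<in> {0<..<1} \<Longrightarrow> (H has_real_derivative h z) (at z)"
    and cont: "continuous_on {0<..<1} h"
    and integ: "set_integrable lborel {0<..<1} h \<or> (\<forall>z\<in>{0<..<1}. 0 \<le> h z)"
    and H: "continuous_on {0..1} H"
  shows "set_integrable lborel {0<..<1} h" "(LBINT z:{0<..<1}. h z) = H 1 - H 0"
proof -
  have 0: "(H \<longlongrightarrow> H 0) (at_right 0)" and 1: "(H \<longlongrightarrow> H 1) (at_left 1)"
    using H continuous_on_Icc_at_leftD continuous_on_Icc_at_rightD by fastforce+
  show "set_integrable lborel {0<..<1} h" "(LBINT z:{0<..<1}. h z) = H 1 - H 0"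
    using unit_interval_FTC[OF deriv cont integ 0 1] by auto
qed

lemma integrable_inverse_sqrt:
  "set_integrable lborel {0<..<1} (\<lambda>z::real. 1 / sqrt (1 - z))"
  "(LBINT z:{0<..<1}. 1 / sqrt (1 - z)) = 2"
proof -
  have d: "((\<lambda>z. - 2 * sqrt (1 - z)) has_real_derivative 1 / sqrt (1 - z)) (at z)"
    if "z \<in> {0<..<1}" for z :: real
    using that by (auto intro!: derivative_eq_intros simp: field_simps)
  have "continuous_on {0<..<1} (\<lambda>z::real. 1 / sqrt (1 - z))"
    and "continuous_on {0..1} (\<lambda>z::real. - 2 * sqrt (1 - z))"
    by (auto intro!: continuous_intros)
  from unit_interval_FTC_closed[OF d this(1) _ this(2)]
  show "set_integrable lborel {0<..<1} (\<lambda>z::real. 1 / sqrt (1 - z))"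
    "(LBINT z:{0<..<1}. 1 / sqrt (1 - z)) = 2" by auto
qed

text \<open>This quantity measures how far the potential is from the rigid sphere limit \<open>p \<rightarrow> \<infinity>\<close>.\<close>

definition tail_moment :: "real \<Rightarrow> real" where
  "tail_moment p = (LBINT z:{0<..<1}. z powr p / sqrt (1 - z))"

lemma tail_moment_integrable:
  assumes "p > 0" shows "set_integrable lborel {0<..<1} (\<lambda>z. z powr p / sqrt (1 - z))"
  using assms by (intro set_integrable_dominated[OF _ _ integrable_inverse_sqrt(1)])
     (auto intro!: divide_right_mono simp: powr_le1)

lemma tail_moment_nonneg: "tail_moment p \<ge> 0"
  unfolding tail_moment_def set_lebesgue_integral_def
  by (intro Bochner_Integration.integral_nonneg) (auto simp: indicator_def)

lemma tail_moment_tendsto_0: "(tail_moment \<longlongrightarrow> 0) at_top"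
proof -
  have "((\<lambda>p. LINT z|lborel. indicator {0<..<1} z *\<^sub>R (z powr p / sqrt (1 - z))) \<longlongrightarrow>
        (LINT z::real|lborel. (0::real))) at_top"
  proof (rule integral_dominated_convergence_at_top[where M = lborel and f = "\<lambda>z. 0::real"
        and s = "\<lambda>p z. indicator {0<..<1} z *\<^sub>R (z powr p / sqrt (1 - z))"
        and w = "\<lambda>z. indicator {0<..<1} z *\<^sub>R (1 / sqrt (1 - z))"])
    show "\<forall>\<^sub>F p in at_top. AE z in lborel. norm (indicator {0<..<1} z *\<^sub>R (z powr p / sqrt (1 - z)))
            \<le> indicator {0<..<1} z *\<^sub>R (1 / sqrt (1 - z))"
      using eventually_gt_at_top[of 0]
      by eventually_elim (auto intro!: AE_I2 divide_right_mono simp: indicator_def powr_le1)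
    show "AE z in lborel. ((\<lambda>p. indicator {0<..<1} z *\<^sub>R (z powr p / sqrt (1 - z))) \<longlongrightarrow> 0) at_top"
    proof (intro AE_I2)
      fix z :: real
      have "((\<lambda>p. z powr p) \<longlongrightarrow> 0) at_top" if "0 < z" "z < 1"
        using that by real_asymp
      then show "((\<lambda>p. indicator {0<..<1} z *\<^sub>R (z powr p / sqrt (1 - z))) \<longlongrightarrow> 0) at_top"
        by (auto simp: indicator_def intro: tendsto_divide_zero)
    qed
  qed (use integrable_inverse_sqrt in \<open>auto simp: set_integrable_def\<close>)
  then show ?thesis
    unfolding tail_moment_def set_lebesgue_integral_def by simp
qed

section \<open>The apsidal angle as a function of the turning point\<close>

text \<open>Both gaps \<open>1 - z\<^sup>p\<close> and \<open>1 - z\<close> vanish to first order at \<open>z = 1\<close>, and \<open>p\<close> bounds the slope of \<open>z\<^sup>p\<close>.\<close>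

lemma powr_gap_bounds:
  fixes p z :: real
  assumes "p \<ge> 1" "z \<in> {0<..<1}"
  shows "1 - z \<le> 1 - z powr p" "1 - z powr p \<le> p * (1 - z)"
proof -
  show "1 - z \<le> 1 - z powr p"
    using powr_mono'[of 1 p z] assms by auto
  have "\<exists>\<xi>. z < \<xi> \<and> \<xi> < 1 \<and> 1 powr p - z powr p = (1 - z) * (p * \<xi> powr (p - 1))"
    using assms by (intro MVT2) (auto intro!: derivative_eq_intros simp: powr_diff field_simps)
  then obtain \<xi> where \<xi>: "z < \<xi>" "\<xi> < 1" "1 - z powr p = (1 - z) * (p * \<xi> powr (p - 1))"
    by auto
  moreover have "\<xi> powr (p - 1) \<le> 1" using \<xi> assms by (intro powr_le1) auto
  ultimately show "1 - z powr p \<le> p * (1 - z)"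
    using assms by (simp add: mult_le_cancel_left1)
qed

text \<open>This is \<open>D\<close>, the radicand \<open>1 - y\<^sup>2 - (y / \<beta>)\<^sup>p\<close> at \<open>y = x z\<close>, where \<open>x\<close> is the turning
  point that belongs to \<open>\<beta>\<close>. Written as a convex combination, its lower bound \<open>1 - z\<close> is evident.\<close>

definition radicand :: "real \<Rightarrow> real \<Rightarrow> real \<Rightarrow> real" where
  "radicand p x z = x\<^sup>2 * (1 - z\<^sup>2) + (1 - x\<^sup>2) * (1 - z powr p)"

lemma radicand_eq: "radicand p x z = 1 - x\<^sup>2 * z\<^sup>2 - (1 - x\<^sup>2) * z powr p"
  by (simp add: radicand_def algebra_simps)

lemma radicand_bounds:
  assumes "p \<ge> 1" "x \<in> {0..1}" "z \<in> {0<..<1}"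
  shows "1 - z \<le> radicand p x z" "radicand p x z \<le> 1"
    "(1 - x\<^sup>2) * (1 - z powr p) \<le> radicand p x z"
proof -
  have x: "0 \<le> x\<^sup>2" "x\<^sup>2 \<le> 1" using assms by (auto intro: power_le_one)
  have z: "1 - z \<le> 1 - z\<^sup>2" "z\<^sup>2 \<le> 1"
    using assms by (auto simp: power2_eq_square mult_le_cancel_right1 intro: mult_le_one)
  have "x\<^sup>2 * (1 - z) + (1 - x\<^sup>2) * (1 - z) \<le> radicand p x z"
    unfolding radicand_def using x z powr_gap_bounds[of p z] assms
    by (intro add_mono mult_left_mono) auto
  then show "1 - z \<le> radicand p x z" by (simp add: algebra_simps)
  have "0 \<le> x\<^sup>2 * z\<^sup>2" "0 \<le> (1 - x\<^sup>2) * z powr p" using x by auto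
  then show "radicand p x z \<le> 1" unfolding radicand_eq by linarith
  show "(1 - x\<^sup>2) * (1 - z powr p) \<le> radicand p x z"
    using x z by (simp add: radicand_def)
qed

text \<open>These are \<open>F\<close> and \<open>G\<close>. Over the fixed domain \<open>(0,1)\<close>, in contrast to the integral from \<open>0\<close> to the
  turning point, the parameter occurs in the integrand only.\<close>

definition swept_angle :: "real \<Rightarrow> real \<Rightarrow> real" where
  "swept_angle p x = (LBINT z:{0<..<1}. x / sqrt (radicand p x z))"

definition swept_rate :: "real \<Rightarrow> real \<Rightarrow> real" where
  "swept_rate p x =
     (LBINT z:{0<..<1}. (1 - z powr p) / (radicand p x z * sqrt (radicand p x z)))"

lemma radicand_measurable [measurable]: "radicand p x \<in> borel_measurable borel"
  unfolding radicand_def by measurable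

context
  fixes p :: real
  assumes p: "p \<ge> 1"
begin

lemma angle_integrand_integrable:
  assumes x: "x \<in> {0..1}"
  shows "set_integrable lborel {0<..<1} (\<lambda>z. x / sqrt (radicand p x z))"
proof (rule set_integrable_dominated[OF _ _ integrable_inverse_sqrt(1)])
  fix z :: real assume z: "z \<in> {0<..<1}"
  note b = radicand_bounds[OF p x z]
  have "x / sqrt (radicand p x z) \<le> 1 / sqrt (1 - z)"
    using x z b by (intro frac_le) auto
  then show "\<bar>x / sqrt (radicand p x z)\<bar> \<le> 1 / sqrt (1 - z)"
    using x z b by simp
qed simp_all

lemma rate_integrand_bounds:
  assumes x: "x \<in> {0..1}" and z: "z \<in> {0<..<1}"
  defines "D \<equiv> radicand p x z"
  shows "1 - z \<le> (1 - z powr p) / (D * sqrt D)"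
    "(1 - z powr p) / (D * sqrt D) \<le> p * (1 / sqrt (1 - z))"
proof -
  note b = radicand_bounds[OF p x z, folded D_def] powr_gap_bounds[OF p z]
  have D: "0 < D" using b z by auto
  have sD: "D * sqrt D \<le> 1 * 1" using b D by (intro mult_mono) auto
  have "1 - z \<le> 1 - z powr p" by (rule b)
  also have "\<dots> \<le> (1 - z powr p) / (D * sqrt D)"
    using b D sD z by (simp add: le_divide_eq mult_left_le)
  finally show "1 - z \<le> (1 - z powr p) / (D * sqrt D)" .
  have "(1 - z powr p) / (D * sqrt D) \<le> (p * (1 - z)) / ((1 - z) * sqrt (1 - z))"
    using b D z by (intro frac_le mult_mono) auto
  also have "\<dots> = p * (1 / sqrt (1 - z))" using z by simp
  finally show "(1 - z powr p) / (D * sqrt D) \<le> p * (1 / sqrt (1 - z))" .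
qed

lemma rate_bound_integrable:
  "set_integrable lborel {0<..<1} (\<lambda>z::real. p * (1 / sqrt (1 - z)))"
  using integrable_inverse_sqrt(1) by (rule set_integrable_mult_right)

lemma rate_integrand_integrable:
  assumes x: "x \<in> {0..1}"
  shows "set_integrable lborel {0<..<1}
     (\<lambda>z. (1 - z powr p) / (radicand p x z * sqrt (radicand p x z)))"
proof (rule set_integrable_dominated[OF _ _ rate_bound_integrable])
  fix z :: real assume z: "z \<in> {0<..<1}"
  show "\<bar>(1 - z powr p) / (radicand p x z * sqrt (radicand p x z))\<bar> \<le> p * (1 / sqrt (1 - z))"
    using rate_integrand_bounds[OF x z] z by auto
qed simp_all

lemma swept_rate_bounds:
  assumes x: "x \<in> {0..1}"
  shows "1/2 \<le> swept_rate p x" "swept_rate p x \<le> 2 * p"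
proof -
  have d: "((\<lambda>z. z - z\<^sup>2 / 2) has_real_derivative 1 - z) (at z)" for z :: real
    by (auto intro!: derivative_eq_intros)
  have c: "continuous_on {0<..<1} (\<lambda>z::real. 1 - z)"
    "continuous_on {0..1} (\<lambda>z::real. z - z\<^sup>2 / 2)" by (auto intro!: continuous_intros)
  have lin: "set_integrable lborel {0<..<1} (\<lambda>z::real. 1 - z)"
    "(LBINT z:{0<..<1}. 1 - z) = (1/2 :: real)"
    using unit_interval_FTC_closed[OF d c(1) _ c(2)] by auto
  have "(LBINT z:{0<..<1}. 1 - z) \<le> swept_rate p x"
    unfolding swept_rate_def
    by (intro set_integral_mono lin rate_integrand_integrable rate_integrand_bounds x)
  then show "1/2 \<le> swept_rate p x" using lin by simp
  have "swept_rate p x \<le> (LBINT z:{0<..<1}. p * (1 / sqrt (1 - z)))"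
    unfolding swept_rate_def
    by (intro set_integral_mono rate_bound_integrable rate_integrand_integrable
        rate_integrand_bounds x)
  also have "\<dots> = p * 2"
    using integrable_inverse_sqrt by (subst set_integral_mult_right) auto
  finally show "swept_rate p x \<le> 2 * p" by simp
qed

text \<open>The numerator simplifies because \<open>D - x/2 \<cdot> \<partial>D/\<partial>x = 1 - z\<^sup>p\<close>, in which \<open>x\<close> no longer occurs. This
  makes the derivative positive without any case distinction in \<open>p\<close>.\<close>

lemma swept_angle_deriv:
  assumes x: "x \<in> {0..1}"
  shows "(swept_angle p has_real_derivative swept_rate p x) (at x within {0..1})"
  unfolding swept_angle_def[abs_def] swept_rate_def
proof (rule has_real_derivative_set_LINT[OF _ _ x, where w = "\<lambda>z. p * (1 / sqrt (1 - z))"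
      and f' = "\<lambda>x z. (1 - z powr p) / (radicand p x z * sqrt (radicand p x z))"])
  fix u z :: real assume u: "u \<in> {0..1}" and z: "z \<in> {0<..<1}"
  define D where "D = radicand p u z"
  have D: "D > 0" using radicand_bounds[OF p u z] z unfolding D_def by auto
  have dD: "((\<lambda>u. radicand p u z) has_real_derivative 2 * u * (z powr p - z\<^sup>2)) (at u within {0..1})"
    unfolding radicand_def by (auto intro!: derivative_eq_intros simp: algebra_simps)
  have "((\<lambda>u. u / sqrt (radicand p u z)) has_real_derivative
      (1 * sqrt D - u * (2 * u * (z powr p - z\<^sup>2) * (inverse (sqrt D) / 2))) / (sqrt D * sqrt D))
      (at u within {0..1})"
    using D unfolding D_def by (auto intro!: derivative_eq_intros dD)
  also have "(1 * sqrt D - u * (2 * u * (z powr p - z\<^sup>2) * (inverse (sqrt D) / 2))) / (sqrt D * sqrt D)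
     = (D - u\<^sup>2 * (z powr p - z\<^sup>2)) / (D * sqrt D)"
    using D by (simp add: field_simps power2_eq_square)
  also have "D - u\<^sup>2 * (z powr p - z\<^sup>2) = 1 - z powr p"
    unfolding D_def radicand_def by (simp add: algebra_simps)
  finally show "((\<lambda>u. u / sqrt (radicand p u z)) has_real_derivative
      (1 - z powr p) / (radicand p u z * sqrt (radicand p u z))) (at u within {0..1})"
    by (simp add: D_def)
  show "\<bar>(1 - z powr p) / (radicand p u z * sqrt (radicand p u z))\<bar> \<le> p * (1 / sqrt (1 - z))"
    using rate_integrand_bounds[OF u z] z by auto
qed (use angle_integrand_integrable rate_bound_integrable in auto)

lemma continuous_on_swept_rate: "continuous_on {0..1} (swept_rate p)"
  unfolding swept_rate_def[abs_def]
proof (rule continuous_on_set_LINT[OF _ _ _ _ rate_bound_integrable])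
  fix z :: real assume z: "z \<in> {0<..<1}"
  have "radicand p u z \<noteq> 0" if "u \<in> {0..1}" for u
    using radicand_bounds[OF p that z] z by auto
  moreover have "continuous_on {0..1} (\<lambda>u. radicand p u z)"
    unfolding radicand_def by (intro continuous_intros)
  ultimately show "continuous_on {0..1}
      (\<lambda>u. (1 - z powr p) / (radicand p u z * sqrt (radicand p u z)))"
    by (intro continuous_intros) auto
  fix u :: real assume u: "u \<in> {0..1}"
  show "\<bar>(1 - z powr p) / (radicand p u z * sqrt (radicand p u z))\<bar> \<le> p * (1 / sqrt (1 - z))"
    using rate_integrand_bounds[OF u z] z by auto
qed auto

lemma swept_angle_increment:
  assumes "0 \<le> a" "a \<le> b" "b \<le> 1"
  shows "(b - a) / 2 \<le> swept_angle p b - swept_angle p a"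
    "swept_angle p b - swept_angle p a \<le> 2 * p * (b - a)"
proof -
  have "\<exists>c\<in>{a..b}. swept_angle p b - swept_angle p a = swept_rate p c * (b - a)"
  proof (cases "a = b")
    case False
    have "(swept_angle p has_derivative (\<lambda>h. h * swept_rate p c)) (at c within {a..b})"
      if "a \<le> c" "c \<le> b" for c
      using has_field_derivative_subset[OF swept_angle_deriv, of c "{a..b}"] that assms
      by (auto simp: has_field_derivative_def mult_commute_abs)
    from mvt_simple[of a b "swept_angle p" "\<lambda>c h. h * swept_rate p c", OF _ this]
    show ?thesis using False assms by (force simp: mult.commute)
  qed auto
  then obtain c where c: "c \<in> {a..b}"
    "swept_angle p b - swept_angle p a = swept_rate p c * (b - a)" by blast
  have "1/2 \<le> swept_rate p c" "swept_rate p c \<le> 2 * p"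
    using swept_rate_bounds[of c] c assms by auto
  then show "(b - a) / 2 \<le> swept_angle p b - swept_angle p a"
    "swept_angle p b - swept_angle p a \<le> 2 * p * (b - a)"
    unfolding c(2) using assms mult_right_mono[of "1/2" "swept_rate p c" "b - a"]
      mult_right_mono[of "swept_rate p c" "2 * p" "b - a"] by auto
qed

lemma swept_angle_0: "swept_angle p 0 = 0"
  by (simp add: swept_angle_def)

text \<open>At \<open>x = 1\<close> the potential drops out of the radicand and the integral is that of \<open>arcsin\<close>.\<close>

lemma swept_angle_1: "swept_angle p 1 = pi / 2"
proof -
  have d: "(arcsin has_real_derivative 1 / sqrt (1 - z\<^sup>2)) (at z)" if "z \<in> {0<..<1}" for z
    using that by (auto intro!: derivative_eq_intros simp: field_simps)
  have "continuous_on {0<..<1} (\<lambda>z::real. 1 / sqrt (1 - z\<^sup>2))"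
    by (intro continuous_intros) (auto simp: power_eq_1_iff power_strict_decreasing_iff abs_square_eq_1)
  moreover have "\<forall>z\<in>{0<..<1::real}. 0 \<le> 1 / sqrt (1 - z\<^sup>2)"
    by (auto simp: abs_square_le_1)
  moreover have "continuous_on {0..1} arcsin" by (rule continuous_on_subset[OF continuous_on_arcsin']) auto
  ultimately show ?thesis
    using unit_interval_FTC_closed(2)[OF d] by (simp add: swept_angle_def radicand_def)
qed

lemma swept_angle_strict_mono:
  assumes "0 \<le> a" "a < b" "b \<le> 1"
  shows "swept_angle p a < swept_angle p b"
  using swept_angle_increment(1)[of a b] assms by auto

lemma continuous_on_swept_angle: "continuous_on {0..1} (swept_angle p)"
  using swept_angle_deriv by (blast intro: DERIV_continuous_on)

lemma swept_angle_surj: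
  assumes "0 \<le> \<phi>" "\<phi> < pi / 2"
  obtains x where "0 \<le> x" "x < 1" "swept_angle p x = \<phi>"
proof -
  obtain x where x: "0 \<le> x" "x \<le> 1" "swept_angle p x = \<phi>"
    using IVT'[of "swept_angle p" 0 \<phi> 1] assms swept_angle_0 swept_angle_1
      continuous_on_swept_angle by auto
  with assms swept_angle_1 have "x \<noteq> 1" by auto
  with x that show ?thesis by force
qed

lemma swept_angle_range:
  assumes "0 < x" "x < 1"
  shows "0 < swept_angle p x" "swept_angle p x < pi / 2"
  using swept_angle_strict_mono[of 0 x] swept_angle_strict_mono[of x 1] assms
    swept_angle_0 swept_angle_1 by auto

end

section \<open>From the turning point to the collision kernel\<close>

text \<open>The impact parameter solved from the turning point equation.\<close>

definition impact_at :: "real \<Rightarrow> real \<Rightarrow> real" where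
  "impact_at p x = x * (1 - x\<^sup>2) powr (- (1 / p))"

lemma impact_at_pos:
  assumes "0 < x" "x < 1" shows "impact_at p x > 0"
  using assms abs_square_less_1[of x] by (simp add: impact_at_def)

lemma impact_at_scaling:
  assumes "p > 0" "0 < x" "x < 1"
  shows "(x / impact_at p x) powr p = 1 - x\<^sup>2"
proof -
  have t: "1 - x\<^sup>2 > 0" using assms abs_square_less_1[of x] by simp
  have "x / impact_at p x = (1 - x\<^sup>2) powr (1 / p)"
    using assms t by (simp add: impact_at_def powr_minus field_simps)
  then show ?thesis using assms t by (simp add: powr_powr)
qed

lemma turning_point_eqI:
  assumes s: "s > 1" and \<beta>: "\<beta> > 0" and x: "0 < x" "x < 1"
    and root: "1 - x\<^sup>2 - (x / \<beta>) powr (s - 1) = 0"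
  shows "turning_point s \<beta> = x"
proof -
  have mono: "a\<^sup>2 + (a / \<beta>) powr (s - 1) < b\<^sup>2 + (b / \<beta>) powr (s - 1)" if "0 < a" "a < b" for a b
    using that s \<beta> by (intro add_strict_mono power_strict_mono powr_less_mono2)
      (auto simp: divide_strict_right_mono)
  have "(THE x. 0 < x \<and> x < 1 \<and> 1 - x\<^sup>2 - (x / \<beta>) powr (s - 1) = 0) = x"
  proof (rule the_equality)
    fix y assume y: "0 < y \<and> y < 1 \<and> 1 - y\<^sup>2 - (y / \<beta>) powr (s - 1) = 0"
    then have "y\<^sup>2 + (y / \<beta>) powr (s - 1) = x\<^sup>2 + (x / \<beta>) powr (s - 1)" using root by simp
    then show "y = x" using mono[of x y] mono[of y x] x y by (cases x y rule: linorder_cases) auto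
  qed (use x root in auto)
  then show ?thesis using \<beta> by (simp add: turning_point_def)
qed

lemma turning_point_impact_at:
  assumes "s > 1" "0 \<le> x" "x < 1"
  shows "turning_point s (impact_at (s - 1) x) = x"
proof (cases "x = 0")
  case True then show ?thesis by (simp add: turning_point_def impact_at_def)
next
  case False
  with assms show ?thesis
    by (intro turning_point_eqI) (auto simp: impact_at_pos impact_at_scaling)
qed

lemma impact_at_surj:
  assumes p: "p > 0" and \<beta>: "\<beta> \<ge> 0"
  obtains x where "0 \<le> x" "x < 1" "impact_at p x = \<beta>"
proof (cases "\<beta> = 0")
  case True then show ?thesis using that[of 0] by (simp add: impact_at_def)
next
  case False
  define h where "h x = x\<^sup>2 + (x / \<beta>) powr p" for x
  have "continuous_on {0..1} h"
    unfolding h_def using p \<beta> False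
    by (intro continuous_on_add continuous_on_power continuous_on_id continuous_on_powr'
        continuous_on_divide continuous_on_const) auto
  moreover have "h 0 \<le> 1" "1 \<le> h 1" by (auto simp: h_def)
  ultimately obtain x where x: "0 \<le> x" "x \<le> 1" "h x = 1"
    using IVT'[of h 0 1 1] by auto
  have "x \<noteq> 0" using x by (auto simp: h_def)
  moreover have "x \<noteq> 1" using x \<beta> False by (auto simp: h_def)
  ultimately have x01: "0 < x" "x < 1" using x by auto
  have "(x / \<beta>) powr p = 1 - x\<^sup>2" using x by (simp add: h_def)
  moreover have "((x / \<beta>) powr p) powr (1 / p) = x / \<beta>"
    using p x01 \<beta> by (simp add: powr_powr)
  ultimately have "(1 - x\<^sup>2) powr (1 / p) = x / \<beta>" by simp
  then have "impact_at p x = \<beta>"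
    using x01 by (simp add: impact_at_def powr_minus)
  with x01 that[of x] show ?thesis by simp
qed

lemma impact_at_deriv:
  assumes p: "p > 0" and x: "0 < x" "x < 1"
  shows "(impact_at p has_real_derivative
           (1 - x\<^sup>2) powr (- (1 / p)) * (1 + 2 * x\<^sup>2 / (p * (1 - x\<^sup>2)))) (at x)"
proof -
  have t: "1 - x\<^sup>2 > 0" using x abs_square_less_1[of x] by simp
  have "((\<lambda>x. (1 - x\<^sup>2) powr (- (1 / p))) has_real_derivative
      - (1 / p) * (1 - x\<^sup>2) powr (- (1 / p) - 1) * (- 2 * x)) (at x)"
    using t by (intro DERIV_chain2[OF has_real_derivative_powr])
      (auto intro!: derivative_eq_intros)
  then have "(impact_at p has_real_derivative 1 * (1 - x\<^sup>2) powr (- (1 / p)) +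
      (- (1 / p) * (1 - x\<^sup>2) powr (- (1 / p) - 1) * (- 2 * x)) * x) (at x)"
    unfolding impact_at_def[abs_def] by (intro DERIV_mult DERIV_ident)
  also have "1 * (1 - x\<^sup>2) powr (- (1 / p)) +
      (- (1 / p) * (1 - x\<^sup>2) powr (- (1 / p) - 1) * (- 2 * x)) * x =
      (1 - x\<^sup>2) powr (- (1 / p)) * (1 + 2 * x\<^sup>2 / (p * (1 - x\<^sup>2)))"
  proof -
    define q where "q = (1 - x\<^sup>2) powr (- (1 / p))"
    have q': "(1 - x\<^sup>2) powr (- (1 / p) - 1) = q / (1 - x\<^sup>2)"
      using t powr_diff[of "1 - x\<^sup>2" "- (1 / p)" 1] by (simp add: q_def)
    show ?thesis
      unfolding q' q_def[symmetric] using t p by (simp add: field_simps power2_eq_square)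
  qed
  finally show ?thesis .
qed

text \<open>This is the substitution \<open>y = x z\<close>, together with \<open>(x / \<beta>)\<^sup>p = 1 - x\<^sup>2\<close>.\<close>

lemma apsidal_angle_impact_at:
  assumes s: "s \<ge> 2" and x: "0 \<le> x" "x < 1"
  shows "apsidal_angle s (impact_at (s - 1) x) = swept_angle (s - 1) x"
proof (cases "x = 0")
  case True
  have "(LBINT y:{0..0}. f y) = 0" for f :: "real \<Rightarrow> real"
  proof -
    have "AE y in lborel. indicator {0..0} y *\<^sub>R f y = 0"
      using AE_lborel_singleton[of 0] by eventually_elim (simp add: indicator_def)
    then show ?thesis unfolding set_lebesgue_integral_def by (rule integral_eq_zero_AE)
  qed
  with True show ?thesis
    by (simp add: apsidal_angle_def turning_point_def impact_at_def swept_angle_def)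
next
  case False
  define p where "p = s - 1"
  define \<beta> where "\<beta> = impact_at p x"
  have x0: "0 < x" using x False by simp
  have \<beta>: "\<beta> > 0" using impact_at_pos x0 x by (simp add: \<beta>_def)
  have tp: "turning_point s \<beta> = x"
    unfolding \<beta>_def p_def using turning_point_impact_at s x by simp
  have "apsidal_angle s \<beta>
      = x * (LINT z|lborel. indicator {0..x} (x * z) / sqrt (1 - (x * z)\<^sup>2 - (x * z / \<beta>) powr p))"
    unfolding apsidal_angle_def tp set_lebesgue_integral_def p_def[symmetric]
    by (subst lborel_integral_real_affine[where c = x and t = 0]) (use x0 in auto)
  also have "\<dots> = (LINT z|lborel. x * (indicator {0..x} (x * z) / sqrt (1 - (x * z)\<^sup>2 - (x * z / \<beta>) powr p)))"
    by (simp only: integral_mult_right_zero)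
  also have "\<dots> = (LINT z|lborel. indicator {0<..<1} z *\<^sub>R (x / sqrt (radicand p x z)))"
  proof (rule integral_cong_AE)
    have "AE z in lborel. z \<noteq> (0::real) \<and> z \<noteq> 1"
      by (intro AE_conjI AE_lborel_singleton)
    then show "AE z in lborel.
        x * (indicator {0..x} (x * z) / sqrt (1 - (x * z)\<^sup>2 - (x * z / \<beta>) powr p)) =
        indicator {0<..<1} z *\<^sub>R (x / sqrt (radicand p x z))"
    proof eventually_elim
      case (elim z)
      show ?case
      proof (cases "z \<in> {0<..<1}")
        case True
        have "x * z / \<beta> = (x / \<beta>) * z" by simp
        then have "(x * z / \<beta>) powr p = (x / \<beta>) powr p * z powr p"
          using True x0 \<beta> by (simp only: powr_mult)
        also have "(x / \<beta>) powr p = 1 - x\<^sup>2"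
          unfolding \<beta>_def using impact_at_scaling s x0 x by (simp add: p_def)
        finally have "1 - (x * z)\<^sup>2 - (x * z / \<beta>) powr p = radicand p x z"
          by (simp add: radicand_eq power_mult_distrib)
        moreover have "x * z \<in> {0..x}" using True x0 by (auto simp: mult_left_le)
        ultimately show ?thesis using True by (simp add: indicator_def)
      next
        case False
        with elim have "x * z \<notin> {0..x}"
          using x0 by (auto simp: zero_le_mult_iff mult_le_cancel_left1)
        with False have "indicat_real {0..x} (x * z) = 0" "indicat_real {0<..<1} z = 0"
          by (simp_all only: indicator_simps not_False_eq_True)
        then show ?thesis by simp
      qed
    qed
  qed auto
  also have "\<dots> = swept_angle p x" by (simp add: swept_angle_def set_lebesgue_integral_def)
  finally show ?thesis by (simp add: \<beta>_def p_def)
qed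

lemma deviation_angle_impact_at:
  assumes "s \<ge> 2" "0 \<le> x" "x < 1"
  shows "deviation_angle s (impact_at (s - 1) x) = pi - 2 * swept_angle (s - 1) x"
  using assms by (simp add: deviation_angle_def apsidal_angle_impact_at)

lemma impact_at_nonneg: "0 \<le> x \<Longrightarrow> 0 \<le> impact_at p x"
  by (simp add: impact_at_def)

lemma inj_on_deviation_angle:
  assumes s: "s \<ge> 2"
  shows "inj_on (deviation_angle s) {0..}"
proof (rule inj_onI)
  fix a b assume a: "a \<in> {0..}" and b: "b \<in> {0..}" and eq: "deviation_angle s a = deviation_angle s b"
  have p: "s - 1 > 0" "s - 1 \<ge> 1" using s by auto
  obtain x where x: "0 \<le> x" "x < 1" "impact_at (s - 1) x = a"
    using impact_at_surj[OF p(1), of a] a by auto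
  obtain y where y: "0 \<le> y" "y < 1" "impact_at (s - 1) y = b"
    using impact_at_surj[OF p(1), of b] b by auto
  have "swept_angle (s - 1) x = swept_angle (s - 1) y"
    using eq deviation_angle_impact_at[OF s] x y by auto
  then have "x = y"
    using swept_angle_strict_mono[OF p(2), of x y] swept_angle_strict_mono[OF p(2), of y x] x y
    by (cases x y rule: linorder_cases) auto
  with x y show "a = b" by simp
qed

lemma impact_parameter_swept_angle:
  assumes "s \<ge> 2" "0 \<le> x" "x < 1"
  shows "impact_parameter s (pi - 2 * swept_angle (s - 1) x) = impact_at (s - 1) x"
  using the_inv_into_f_f[OF inj_on_deviation_angle, of s "impact_at (s - 1) x"] assms
  by (simp add: impact_parameter_def deviation_angle_impact_at impact_at_nonneg)

lemma deviation_angle_cases: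
  assumes s: "s \<ge> 2" and \<theta>: "0 < \<theta>" "\<theta> < pi"
  obtains x where "0 < x" "x < 1" "\<theta> = pi - 2 * swept_angle (s - 1) x"
proof -
  have p: "s - 1 \<ge> 1" using s by simp
  obtain x where x: "0 \<le> x" "x < 1" "swept_angle (s - 1) x = (pi - \<theta>) / 2"
    using swept_angle_surj[OF p, of "(pi - \<theta>) / 2"] \<theta> by auto
  with \<theta> swept_angle_0[OF p] have "x \<noteq> 0" by auto
  with x show ?thesis by (intro that[of x]) auto
qed

text \<open>Only the map \<open>x \<mapsto> \<theta>\<close> has to be inverted, since \<open>\<beta>\<close> is explicit in \<open>x\<close>; the chain rule does the
  rest.\<close>

lemma impact_parameter_deriv:
  assumes s: "s \<ge> 2" and x: "0 < x" "x < 1"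
  defines "p \<equiv> s - 1"
  shows "(impact_parameter s has_real_derivative
     - ((1 - x\<^sup>2) powr (- (1 / p)) * (1 + 2 * x\<^sup>2 / (p * (1 - x\<^sup>2))) / (2 * swept_rate p x)))
     (at (pi - 2 * swept_angle p x))"
proof -
  have p: "p \<ge> 1" using s by (simp add: p_def)
  define f where "f y = pi - 2 * swept_angle p y" for y
  define g where "g \<theta> = turning_point s (impact_parameter s \<theta>)" for \<theta>
  have gf: "g (f y) = y" if "0 < y" "y < 1" for y
    using that s by (simp add: g_def f_def p_def impact_parameter_swept_angle turning_point_impact_at)
  have rate: "swept_rate p x > 0" using swept_rate_bounds[OF p, of x] x by auto
  have df: "(f has_real_derivative - (2 * swept_rate p y)) (at y)" if "y \<in> {0<..<1}" for y
  proof -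
    have "(swept_angle p has_real_derivative swept_rate p y) (at y within {0<..<1})"
      using that by (intro has_field_derivative_subset[OF swept_angle_deriv[OF p]]) auto
    then have "(swept_angle p has_real_derivative swept_rate p y) (at y)"
      using that at_within_open[of y "{0<..<1}"] by simp
    from DERIV_diff[OF DERIV_const[of pi] DERIV_cmult[OF this, of 2]]
    show ?thesis by (simp add: f_def[abs_def])
  qed
  have "continuous_on {0<..<1} f"
    using df by (intro DERIV_continuous_on) (auto intro: has_field_derivative_at_within)
  moreover have "(f has_derivative (*) (- (2 * swept_rate p x))) (at x)"
    using df[of x] x by (simp add: has_field_derivative_def)
  ultimately have "(g has_derivative (*) (inverse (- (2 * swept_rate p x)))) (at (f x))"
    using x rate gf
    by (intro has_derivative_inverse_strong[of "{0<..<1}" x f g "(*) (- (2 * swept_rate p x))"])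
      (auto simp: fun_eq_iff)
  then have "(g has_real_derivative inverse (- (2 * swept_rate p x))) (at (f x))"
    by (simp add: has_field_derivative_def)
  then have comp: "((\<lambda>\<theta>. impact_at p (g \<theta>)) has_real_derivative
     (1 - x\<^sup>2) powr (- (1 / p)) * (1 + 2 * x\<^sup>2 / (p * (1 - x\<^sup>2))) * inverse (- (2 * swept_rate p x)))
     (at (f x))"
    using impact_at_deriv[of p x] x p gf by (intro DERIV_chain2[where g = g]) auto
  have ev: "\<forall>\<^sub>F \<theta> in nhds (f x). impact_at p (g \<theta>) = impact_parameter s \<theta>"
  proof -
    have "f x \<in> {0<..<pi}" using swept_angle_range[OF p x] by (auto simp: f_def)
    then have "\<forall>\<^sub>F \<theta> in nhds (f x). \<theta> \<in> {0<..<pi}" by (intro eventually_nhds_in_open) auto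
    then show ?thesis
    proof eventually_elim
      case (elim \<theta>)
      then obtain y where y: "0 < y" "y < 1" "\<theta> = f y"
        using deviation_angle_cases[OF s, of \<theta>] by (auto simp: f_def p_def)
      then have "impact_parameter s \<theta> = impact_at p y"
        unfolding f_def p_def using impact_parameter_swept_angle[OF s, of y] by simp
      with y gf show ?case by simp
    qed
  qed
  from iffD1[OF DERIV_cong_ev[OF refl ev refl] comp]
  show ?thesis unfolding f_def divide_inverse inverse_minus_eq mult_minus_right .
qed

text \<open>The two factors \<open>\<beta>\<close> and \<open>\<beta>'\<close> each contribute \<open>(1 - x\<^sup>2)\<^sup>-\<^sup>1\<^sup>/\<^sup>p\<close>, and \<open>sin \<theta> = sin (2 F(x))\<close>.\<close>

lemma kernel_formula_swept_angle:
  assumes s: "s \<ge> 2" and x: "0 < x" "x < 1"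
  defines "p \<equiv> s - 1"
  shows "kernel_formula s (pi - 2 * swept_angle p x) =
    2 powr (4 / p) * (x * (1 - x\<^sup>2) powr (- (2 / p)) * (1 + 2 * x\<^sup>2 / (p * (1 - x\<^sup>2))))
      / (2 * swept_rate p x * sin (2 * swept_angle p x))"
proof -
  have p: "p \<ge> 1" using s by (simp add: p_def)
  have t: "1 - x\<^sup>2 > 0" using x abs_square_less_1[of x] by simp
  have rate: "swept_rate p x > 0" using swept_rate_bounds[OF p, of x] x by auto
  have "1 + 2 * x\<^sup>2 / (p * (1 - x\<^sup>2)) > 0" using p t by (intro add_pos_nonneg) auto
  then have "\<bar>deriv (impact_parameter s) (pi - 2 * swept_angle p x)\<bar> =
      (1 - x\<^sup>2) powr (- (1 / p)) * (1 + 2 * x\<^sup>2 / (p * (1 - x\<^sup>2))) / (2 * swept_rate p x)"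
    unfolding p_def DERIV_imp_deriv[OF impact_parameter_deriv[OF s x]]
    using rate by (simp add: abs_mult p_def)
  moreover have "impact_parameter s (pi - 2 * swept_angle p x) = x * (1 - x\<^sup>2) powr (- (1 / p))"
    using impact_parameter_swept_angle[OF s, of x] x by (simp add: p_def impact_at_def)
  moreover have "(1 - x\<^sup>2) powr (- (1 / p)) * (1 - x\<^sup>2) powr (- (1 / p)) = (1 - x\<^sup>2) powr (- (2 / p))"
    by (simp flip: powr_add)
  ultimately show ?thesis
    unfolding kernel_formula_def p_def[symmetric] by (simp add: sin_diff mult_ac)
qed

lemma angular_kernel_cos:
  assumes "0 < \<theta>" "\<theta> < pi"
  shows "angular_kernel s (cos \<theta>) = kernel_formula s \<theta>"
proof -
  have "cos \<theta> \<noteq> -1" using cos_monotone_0_pi[of \<theta> pi] assms by auto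
  then show ?thesis using assms by (simp add: angular_kernel_def arccos_cos)
qed

section \<open>The rate at grazing collisions\<close>

lemma one_minus_square_pos: "z \<in> {0<..<1} \<Longrightarrow> 1 - z\<^sup>2 > (0::real)"
  using abs_square_less_1[of z] by simp

lemma one_minus_square_ge:
  assumes "0 < x" "x < (1::real)" shows "1 - x\<^sup>2 > 0" "1 - x \<le> 1 - x\<^sup>2"
  using one_minus_square_pos[of x] assms by (auto simp: power2_eq_square mult_le_cancel_right1)

text \<open>The substitution \<open>t = z\<^sup>2\<close> turns this into Euler's integral for the Beta function.\<close>

lemma powr_over_sqrt_integral:
  fixes p :: real
  assumes p: "p \<ge> 1"
  shows "set_integrable lborel {0<..<1} (\<lambda>z. z powr p / sqrt (1 - z\<^sup>2))"
    and "(LBINT z:{0<..<1}. z powr p / sqrt (1 - z\<^sup>2)) = Beta ((p + 1) / 2) (1 / 2) / 2"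
proof -
  show int: "set_integrable lborel {0<..<1} (\<lambda>z. z powr p / sqrt (1 - z\<^sup>2))"
  proof (rule set_integrable_dominated[OF _ _ integrable_inverse_sqrt(1)])
    fix z :: real assume z: "z \<in> {0<..<1}"
    have "z\<^sup>2 \<le> z" using z by (simp add: power2_eq_square mult_left_le)
    moreover have "z powr p \<le> 1" using z p by (intro powr_le1) auto
    ultimately show "\<bar>z powr p / sqrt (1 - z\<^sup>2)\<bar> \<le> 1 / sqrt (1 - z)"
      using z by (auto intro!: frac_le)
  qed auto
  define f :: "real \<Rightarrow> real" where "f t = t powr ((p + 1) / 2 - 1) * (1 - t) powr (1 / 2 - 1)" for t
  have fg: "f (z\<^sup>2) * (2 * z) = 2 * (z powr p / sqrt (1 - z\<^sup>2))" if z: "z \<in> {0<..<1}" for z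
  proof -
    have t: "1 - z\<^sup>2 > 0" using one_minus_square_pos[OF z] .
    have "(z\<^sup>2) powr ((p + 1) / 2 - 1) * z = z powr (p - 1) * z"
    proof -
      have "(z\<^sup>2) powr ((p + 1) / 2 - 1) = z powr (2 * ((p + 1) / 2 - 1))"
        using z by (simp add: powr_powr flip: powr_numeral)
      also have "2 * ((p + 1) / 2 - 1) = p - 1" by (simp add: field_simps)
      finally show ?thesis using z by simp
    qed
    also have "\<dots> = z powr p" using z powr_add[of z "p - 1" 1] by simp
    finally have "(z\<^sup>2) powr ((p + 1) / 2 - 1) * z = z powr p" .
    moreover have "(1 - z\<^sup>2) powr (1 / 2 - 1) = 1 / sqrt (1 - z\<^sup>2)"
      using t by (simp add: powr_minus_divide powr_half_sqrt)
    ultimately show ?thesis by (simp add: f_def mult_ac)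
  qed
  have int2: "set_integrable lborel {0<..<1} (\<lambda>z. f (z\<^sup>2) * (2 * z))"
    using set_integrable_mult_right[OF int, of 2]
    by (subst set_integrable_cong[OF refl refl fg]) auto
  have sub: "set_integrable lborel (einterval (ereal 0) (ereal 1)) f"
    "(LBINT t=ereal 0..ereal 1. f t) = (LBINT z=ereal 0..ereal 1. f (z\<^sup>2) * (2 * z))"
  proof -
    have lims: "((ereal \<circ> (\<lambda>z. z\<^sup>2) \<circ> real_of_ereal) \<longlongrightarrow> ereal 0) (at_right (ereal 0))"
      "((ereal \<circ> (\<lambda>z. z\<^sup>2) \<circ> real_of_ereal) \<longlongrightarrow> ereal 1) (at_left (ereal 1))"
      unfolding ereal_tendsto_simps by (auto intro!: tendsto_eq_intros)
    have c: "isCont f (z\<^sup>2)" if "ereal 0 < ereal z" "ereal z < ereal 1" for z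
      unfolding f_def using that one_minus_square_pos[of z] by (intro continuous_intros) auto
    have int3: "set_integrable lborel (einterval (ereal 0) (ereal 1)) (\<lambda>z. f (z\<^sup>2) * (2 * z))"
      using int2 by simp
    show "set_integrable lborel (einterval (ereal 0) (ereal 1)) f"
      "(LBINT t=ereal 0..ereal 1. f t) = (LBINT z=ereal 0..ereal 1. f (z\<^sup>2) * (2 * z))"
      by (rule interval_integral_substitution_nonneg[OF _ _ c _ _ _ lims int3];
          auto simp: f_def intro!: derivative_eq_intros)+
  qed
  have "(f has_integral Beta ((p + 1) / 2) (1 / 2)) {0<..<1}"
    using has_integral_Beta_real[of "(p + 1) / 2" "1 / 2"] p
    unfolding f_def[abs_def] has_integral_Icc_iff_Ioo by simp
  then have "(LBINT t:{0<..<1}. f t) = Beta ((p + 1) / 2) (1 / 2)"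
    using set_borel_integral_eq_integral(2)[of "{0<..<1}" f] sub(1)
    by (simp add: integral_unique)
  moreover have "(LBINT t:{0<..<1}. f t) = (LBINT z:{0<..<1}. f (z\<^sup>2) * (2 * z))"
    using sub(2) by (simp add: interval_lebesgue_integral_def)
  moreover have "\<dots> = (LBINT z:{0<..<1}. 2 * (z powr p / sqrt (1 - z\<^sup>2)))"
    by (intro set_lebesgue_integral_cong) (auto simp: fg)
  moreover have "\<dots> = 2 * (LBINT z:{0<..<1}. z powr p / sqrt (1 - z\<^sup>2))"
    by (rule set_integral_mult_right)
  ultimately show "(LBINT z:{0<..<1}. z powr p / sqrt (1 - z\<^sup>2)) = Beta ((p + 1) / 2) (1 / 2) / 2"
    by linarith
qed

text \<open>At \<open>x = 1\<close> the integrand is \<open>(1 - z\<^sup>p)(1 - z\<^sup>2)\<^sup>-\<^sup>3\<^sup>/\<^sup>2\<close>. Integrate by parts with the antiderivative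
  \<open>z (1 - z\<^sup>2)\<^sup>-\<^sup>1\<^sup>/\<^sup>2\<close> of \<open>(1 - z\<^sup>2)\<^sup>-\<^sup>3\<^sup>/\<^sup>2\<close>: the boundary terms vanish, and what remains is a Beta
  integral.\<close>

lemma swept_rate_1:
  assumes p: "p \<ge> 1"
  shows "swept_rate p 1 = sqrt pi * Gamma ((p + 1) / 2) / Gamma (p / 2)"
proof -
  define h where "h z = (1 - z powr p) / ((1 - z\<^sup>2) * sqrt (1 - z\<^sup>2)) - p * (z powr p / sqrt (1 - z\<^sup>2))"
    for z :: real
  define H where "H z = (1 - z powr p) * (z / sqrt (1 - z\<^sup>2))" for z :: real
  have int1: "set_integrable lborel {0<..<1} (\<lambda>z. (1 - z powr p) / ((1 - z\<^sup>2) * sqrt (1 - z\<^sup>2)))"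
    using rate_integrand_integrable[OF p, of 1] by (simp add: radicand_def)
  have int2: "set_integrable lborel {0<..<1} (\<lambda>z. p * (z powr p / sqrt (1 - z\<^sup>2)))"
    using powr_over_sqrt_integral(1)[OF p] by (rule set_integrable_mult_right)
  have int: "set_integrable lborel {0<..<1} h"
    unfolding h_def by (intro set_integral_diff int1 int2)
  have deriv: "(H has_real_derivative h z) (at z)" if z: "z \<in> {0<..<1}" for z
  proof -
    define r where "r = sqrt (1 - z\<^sup>2)"
    have t: "1 - z\<^sup>2 > 0" using one_minus_square_pos[OF z] .
    have r: "r > 0" "r * r = 1 - z\<^sup>2" using t by (simp_all add: r_def)
    have "((\<lambda>z. z / sqrt (1 - z\<^sup>2)) has_real_derivative
        (1 * sqrt (1 - z\<^sup>2) - z * (- (2 * z) * (inverse (sqrt (1 - z\<^sup>2)) / 2))) /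
        (sqrt (1 - z\<^sup>2) * sqrt (1 - z\<^sup>2))) (at z)"
      using t by (auto intro!: derivative_eq_intros)
    also have "(1 * sqrt (1 - z\<^sup>2) - z * (- (2 * z) * (inverse (sqrt (1 - z\<^sup>2)) / 2))) /
        (sqrt (1 - z\<^sup>2) * sqrt (1 - z\<^sup>2)) = (r * r + z\<^sup>2) / ((r * r) * r)"
      unfolding r_def[symmetric] using r(1) by (simp add: field_simps power2_eq_square)
    also have "\<dots> = 1 / ((1 - z\<^sup>2) * sqrt (1 - z\<^sup>2))" unfolding r(2) by (simp add: r_def)
    finally have 1: "((\<lambda>z. z / sqrt (1 - z\<^sup>2)) has_real_derivative
        1 / ((1 - z\<^sup>2) * sqrt (1 - z\<^sup>2))) (at z)" .
    have "((\<lambda>z. 1 - z powr p) has_real_derivative - (p * z powr (p - 1))) (at z)"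
      using z by (auto intro!: derivative_eq_intros)
    from DERIV_mult[OF this 1]
    have "(H has_real_derivative - (p * z powr (p - 1)) * (z / sqrt (1 - z\<^sup>2)) +
        1 / ((1 - z\<^sup>2) * sqrt (1 - z\<^sup>2)) * (1 - z powr p)) (at z)"
      unfolding H_def .
    also have "- (p * z powr (p - 1)) * (z / sqrt (1 - z\<^sup>2)) +
        1 / ((1 - z\<^sup>2) * sqrt (1 - z\<^sup>2)) * (1 - z powr p) = h z"
      using z by (simp add: h_def powr_diff)
    finally show ?thesis .
  qed
  have cont: "continuous_on {0<..<1} h"
    unfolding h_def using one_minus_square_pos by (intro continuous_intros) force+
  have lim0: "(H \<longlongrightarrow> 0) (at_right 0)"
  proof -
    have "\<forall>\<^sub>F z in at_right (0::real). 0 \<le> z"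
      using eventually_at_right_less by (rule eventually_mono) auto
    then show ?thesis
      unfolding H_def using p by (auto intro!: tendsto_eq_intros)
  qed
  \<comment> \<open>at \<open>z = 1\<close> the zero of \<open>1 - z\<^sup>p\<close> beats the singularity, leaving a square root\<close>
  have "((\<lambda>z::real. p * sqrt (1 - z)) \<longlongrightarrow> 0) (at_left 1)"
    by (auto intro!: tendsto_eq_intros)
  moreover have "\<forall>\<^sub>F z in at_left 1. norm (H z) \<le> p * sqrt (1 - z)"
  proof -
    have "\<forall>\<^sub>F z in at_left (1::real). z \<in> {0<..<1}" by (rule eventually_at_leftI[of 0]) auto
    then show ?thesis
    proof eventually_elim
      case (elim z)
      note g = powr_gap_bounds[OF p elim]
      have "z\<^sup>2 \<le> z" using elim by (simp add: power2_eq_square mult_left_le)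
      then have "z / sqrt (1 - z\<^sup>2) \<le> 1 / sqrt (1 - z)" using elim by (intro frac_le) auto
      then have "H z \<le> (p * (1 - z)) * (1 / sqrt (1 - z))"
        unfolding H_def using g elim one_minus_square_pos[OF elim]
        by (intro mult_mono) (auto intro!: divide_nonneg_nonneg)
      also have "\<dots> = p * ((1 - z) / sqrt (1 - z))" by simp
      also have "\<dots> = p * sqrt (1 - z)" using elim by (subst real_div_sqrt) auto
      finally have "H z \<le> p * sqrt (1 - z)" .
      moreover have "H z \<ge> 0" unfolding H_def using g elim one_minus_square_pos[OF elim]
        by (intro mult_nonneg_nonneg divide_nonneg_nonneg) auto
      ultimately show ?case by simp
    qed
  qed
  ultimately have lim1: "(H \<longlongrightarrow> 0) (at_left 1)"
    by (rule Lim_null_comparison[rotated])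
  have "0 = (LBINT z:{0<..<1}. h z)"
    using unit_interval_FTC(2)[OF deriv cont _ lim0 lim1] int by simp
  also have "\<dots> = (LBINT z:{0<..<1}. (1 - z powr p) / ((1 - z\<^sup>2) * sqrt (1 - z\<^sup>2))) -
      (LBINT z:{0<..<1}. p * (z powr p / sqrt (1 - z\<^sup>2)))"
    unfolding h_def by (rule set_integral_diff(2)[OF int1 int2])
  also have "(LBINT z:{0<..<1}. (1 - z powr p) / ((1 - z\<^sup>2) * sqrt (1 - z\<^sup>2))) = swept_rate p 1"
    by (simp add: swept_rate_def radicand_def)
  also have "(LBINT z:{0<..<1}. p * (z powr p / sqrt (1 - z\<^sup>2))) =
      p * (Beta ((p + 1) / 2) (1 / 2) / 2)"
    unfolding powr_over_sqrt_integral(2)[OF p, symmetric] by (rule set_integral_mult_right)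
  finally have "swept_rate p 1 = p / 2 * Beta ((p + 1) / 2) (1 / 2)" by simp
  also have "\<dots> = p / 2 * (Gamma ((p + 1) / 2) * sqrt pi / Gamma (p / 2 + 1))"
  proof -
    have "(p + 1) / 2 + 1 / 2 = p / 2 + 1" by (simp add: field_simps)
    then show ?thesis by (simp only: Beta_def Gamma_one_half_real)
  qed
  also have "Gamma (p / 2 + 1) = p / 2 * Gamma (p / 2)"
    using p by (intro Gamma_plus1) (auto simp: nonpos_Ints_def)
  finally show ?thesis using p by (simp add: field_simps)
qed

section \<open>The kernel near grazing and head-on collisions\<close>

text \<open>The turning point as a function of the deviation angle, i.e. the inverse of \<open>x \<mapsto> \<pi> - 2 F(x)\<close>.\<close>

definition turning_at :: "real \<Rightarrow> real \<Rightarrow> real" where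
  "turning_at s \<theta> = turning_point s (impact_parameter s \<theta>)"

context
  fixes s p :: real
  assumes s: "s \<ge> 2"
  defines "p \<equiv> s - 1"
begin

lemma exponent_ge_1: "p \<ge> 1" using s by (simp add: p_def)

text \<open>The inequalities are the bounds \<open>1/2 \<le> G \<le> 2p\<close> integrated from \<open>x\<close> to \<open>1\<close> and from \<open>0\<close> to \<open>x\<close>,
  where \<open>F(1) = \<pi>/2\<close> and \<open>F(0) = 0\<close>. They relate the convergence of \<open>\<theta>\<close> and of \<open>x\<close> at both ends.\<close>

lemma turning_at:
  assumes \<theta>: "0 < \<theta>" "\<theta> < pi"
  defines "x \<equiv> turning_at s \<theta>"
  shows "0 < x" "x < 1" "\<theta> = pi - 2 * swept_angle p x"
    "1 - x \<le> \<theta>" "\<theta> \<le> 4 * p * (1 - x)" "x \<le> pi - \<theta>"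
proof -
  obtain y where y: "0 < y" "y < 1" "\<theta> = pi - 2 * swept_angle p y"
    using deviation_angle_cases[OF s \<theta>] unfolding p_def by blast
  have "x = y"
    using y impact_parameter_swept_angle[OF s, of y] turning_point_impact_at[of s y] s
    by (simp add: x_def turning_at_def p_def)
  with y show x: "0 < x" "x < 1" "\<theta> = pi - 2 * swept_angle p x" by auto
  show "1 - x \<le> \<theta>" "\<theta> \<le> 4 * p * (1 - x)" "x \<le> pi - \<theta>"
    using swept_angle_increment[OF exponent_ge_1, of x 1] swept_angle_increment[OF exponent_ge_1, of 0 x]
      swept_angle_0[OF exponent_ge_1] swept_angle_1[OF exponent_ge_1] x by auto
qed

lemma turning_at_tendsto_1: "filterlim (turning_at s) (at_left 1) (at_right 0)"
proof -
  have ev: "\<forall>\<^sub>F \<theta> in at_right 0. \<theta> \<in> {0<..<pi}" by (rule eventually_at_rightI[of _ pi]) auto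
  have "((\<lambda>\<theta>. 1 - turning_at s \<theta>) \<longlongrightarrow> 0) (at_right 0)"
  proof (rule tendsto_sandwich)
    show "\<forall>\<^sub>F \<theta> in at_right 0. 0 \<le> 1 - turning_at s \<theta>"
      using ev by eventually_elim (use turning_at in force)
    show "\<forall>\<^sub>F \<theta> in at_right 0. 1 - turning_at s \<theta> \<le> \<theta>"
      using ev by eventually_elim (use turning_at in force)
  qed (auto intro!: tendsto_eq_intros)
  from tendsto_diff[OF tendsto_const this, of 1]
  have "(turning_at s \<longlongrightarrow> 1) (at_right 0)" by simp
  moreover have "\<forall>\<^sub>F \<theta> in at_right 0. turning_at s \<theta> \<in> {..<1} \<and> turning_at s \<theta> \<noteq> 1"
    using ev by eventually_elim (use turning_at in force)
  ultimately show ?thesis by (simp add: filterlim_at)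
qed

lemma turning_at_tendsto_0: "filterlim (turning_at s) (at_right 0) (at_left pi)"
proof -
  have ev: "\<forall>\<^sub>F \<theta> in at_left pi. \<theta> \<in> {0<..<pi}" by (rule eventually_at_leftI[of 0]) auto
  have "(turning_at s \<longlongrightarrow> 0) (at_left pi)"
  proof (rule tendsto_sandwich)
    show "\<forall>\<^sub>F \<theta> in at_left pi. 0 \<le> turning_at s \<theta>"
      using ev by eventually_elim (use turning_at in force)
    show "\<forall>\<^sub>F \<theta> in at_left pi. turning_at s \<theta> \<le> pi - \<theta>"
      using ev by eventually_elim (use turning_at in force)
  qed (auto intro!: tendsto_eq_intros)
  moreover have "\<forall>\<^sub>F \<theta> in at_left pi. turning_at s \<theta> \<in> {0<..} \<and> turning_at s \<theta> \<noteq> 0"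
    using ev by eventually_elim (use turning_at in force)
  ultimately show ?thesis by (simp add: filterlim_at)
qed

text \<open>The powers are arranged so that only the ratio \<open>\<theta> / (1 - x\<^sup>2)\<close> occurs, which has a finite limit at
  grazing collisions.\<close>

lemma weighted_kernel_eq:
  assumes \<theta>: "0 < \<theta>" "\<theta> < pi"
  defines "x \<equiv> turning_at s \<theta>"
  shows "\<theta> powr (1 + 2 / p) * angular_kernel s (cos \<theta>) * sin \<theta> =
    2 powr (4 / p) * (\<theta> / (1 - x\<^sup>2)) powr (2 / p) * (\<theta> + 2 * x\<^sup>2 / p * (\<theta> / (1 - x\<^sup>2))) * x
      / (2 * swept_rate p x)"
proof -
  note x = turning_at(1-3)[OF \<theta>, folded x_def]
  define t where "t = 1 - x\<^sup>2"
  define r where "r = swept_rate p x"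
  have t: "t > 0" using one_minus_square_ge(1)[OF x(1,2)] by (simp add: t_def)
  have r: "r > 0" using swept_rate_bounds(1)[OF exponent_ge_1, of x] x by (simp add: r_def)
  have sin: "sin (2 * swept_angle p x) = sin \<theta>"
    using x(3) by (simp add: sin_diff)
  have "sin \<theta> > 0" using \<theta> by (rule sin_gt_zero)
  have kernel: "angular_kernel s (cos \<theta>) =
      2 powr (4 / p) * (x * t powr (- (2 / p)) * (1 + 2 * x\<^sup>2 / (p * t))) / (2 * r * sin \<theta>)"
    using kernel_formula_swept_angle[OF s x(1,2), folded p_def]
    unfolding angular_kernel_cos[OF \<theta>] t_def r_def sin x(3)[symmetric] .
  have "\<theta> powr (1 + 2 / p) * t powr (- (2 / p)) = \<theta> * (\<theta> powr (2 / p) * t powr (- (2 / p)))"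
    using \<theta> by (simp add: powr_add)
  also have "\<theta> powr (2 / p) * t powr (- (2 / p)) = (\<theta> / t) powr (2 / p)"
    using \<theta> t by (simp add: powr_minus powr_divide field_simps)
  finally have pw: "\<theta> powr (1 + 2 / p) * t powr (- (2 / p)) = \<theta> * (\<theta> / t) powr (2 / p)" .
  have "\<theta> powr (1 + 2 / p) * angular_kernel s (cos \<theta>) * sin \<theta> =
      2 powr (4 / p) * (\<theta> powr (1 + 2 / p) * t powr (- (2 / p))) * x * (1 + 2 * x\<^sup>2 / (p * t)) / (2 * r)"
    unfolding kernel using \<open>sin \<theta> > 0\<close> by simp
  also have "\<dots> = 2 powr (4 / p) * (\<theta> / t) powr (2 / p) * (\<theta> * (1 + 2 * x\<^sup>2 / (p * t))) * x / (2 * r)"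
    unfolding pw by simp
  also have "\<theta> * (1 + 2 * x\<^sup>2 / (p * t)) = \<theta> + 2 * x\<^sup>2 / p * (\<theta> / t)"
    by (simp add: algebra_simps)
  finally show ?thesis by (simp only: t_def r_def)
qed

text \<open>The constant does not depend on \<open>s\<close>: the ratio \<open>\<theta> / (1 - x\<^sup>2)\<close> may grow like \<open>4p\<close>, but it enters
  only divided by \<open>p\<close> or raised to the power \<open>2/p\<close>, and
  \<open>(4p)\<^sup>2\<^sup>/\<^sup>p = exp (2 ln (4p) / p) \<le> exp 8\<close>. The other factors come from \<open>2\<^sup>4\<^sup>/\<^sup>p \<le> 16\<close> and from
  \<open>\<theta> + 2x\<^sup>2/p \<cdot> \<theta>/(1 - x\<^sup>2) \<le> 4 + 8\<close>.\<close>

lemma weighted_kernel_bound: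
  assumes \<theta>: "0 < \<theta>" "\<theta> < pi"
  shows "\<theta> powr (1 + 2 / p) * angular_kernel s (cos \<theta>) * sin \<theta> \<le> 16 * exp 8 * 12"
proof -
  define x where "x = turning_at s \<theta>"
  note x = turning_at[OF \<theta>, folded x_def]
  define t where "t = 1 - x\<^sup>2"
  define r where "r = swept_rate p x"
  have t: "t > 0" "1 - x \<le> t" using one_minus_square_ge[OF x(1,2)] by (simp_all add: t_def)
  have r: "r \<ge> 1 / 2" using swept_rate_bounds(1)[OF exponent_ge_1, of x] x by (simp add: r_def)
  have p: "p \<ge> 1" by (rule exponent_ge_1)
  have "\<theta> \<le> 4 * p * t"
    using x(5) mult_left_mono[OF t(2), of "4 * p"] p by linarith
  then have ratio: "\<theta> / t \<le> 4 * p" using t by (simp add: divide_le_eq)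
  have "2 powr (4 / p) \<le> 2 powr (4::real)" using p by (intro powr_mono) (auto simp: divide_le_eq)
  then have b1: "2 powr (4 / p) \<le> 16" by simp
  have "(\<theta> / t) powr (2 / p) \<le> (4 * p) powr (2 / p)"
    using ratio \<theta> t p by (intro powr_mono2) auto
  also have "\<dots> = exp (2 / p * ln (4 * p))" using p by (simp add: powr_def)
  also have "\<dots> \<le> exp (2 / p * (4 * p))"
    using p ln_bound[of "4 * p"] by (intro exp_le_cancel_iff[THEN iffD2] mult_left_mono) auto
  also have "2 / p * (4 * p) = 8" using p by simp
  finally have b2: "(\<theta> / t) powr (2 / p) \<le> exp 8" .
  have "2 * x\<^sup>2 / p * (\<theta> / t) \<le> 2 * 1 / p * (4 * p)"
    using ratio p \<theta> t x by (intro mult_mono divide_right_mono) (auto intro: power_le_one)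
  then have b3: "\<theta> + 2 * x\<^sup>2 / p * (\<theta> / t) \<le> 12"
    using \<theta> p pi_less_4 by simp
  have nn: "0 \<le> \<theta> + 2 * x\<^sup>2 / p * (\<theta> / t)" using \<theta> p t by simp
  have "2 powr (4 / p) * (\<theta> / t) powr (2 / p) * (\<theta> + 2 * x\<^sup>2 / p * (\<theta> / t)) * x / (2 * r)
      \<le> 16 * exp 8 * 12 * 1 / 1"
    using b1 b2 b3 nn r x by (intro frac_le mult_mono) (auto intro!: mult_nonneg_nonneg)
  then show ?thesis
    unfolding weighted_kernel_eq[OF \<theta>] x_def[symmetric] t_def[symmetric] r_def[symmetric] by simp
qed

text \<open>As \<open>x \<rightarrow> 1\<close>, the ratio is \<open>2 (F(1) - F(x)) / ((1 - x)(1 + x))\<close> and tends to the one-sided derivative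
  \<open>G(1)\<close>.\<close>

lemma weighted_kernel_limit:
  "((\<lambda>\<theta>. \<theta> powr (1 + 2 / p) * angular_kernel s (cos \<theta>) * sin \<theta>) \<longlongrightarrow> grazing_constant s) (at_right 0)"
proof -
  have p: "p \<ge> 1" by (rule exponent_ge_1)
  define r where "r = swept_rate p 1"
  define \<Theta> where "\<Theta> x = pi - 2 * swept_angle p x" for x
  have r: "r \<ge> 1/2" using swept_rate_bounds(1)[OF p, of 1] by (simp add: r_def)
  have at1: "at 1 within {0..1} = at_left (1::real)" by (simp add: at_within_Icc_at_left)
  have "((\<lambda>y. (swept_angle p y - swept_angle p 1) / (y - 1)) \<longlongrightarrow> r) (at_left 1)"
    using swept_angle_deriv[OF p, of 1] unfolding has_field_derivative_iff at1 r_def by simp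
  then have "((\<lambda>x. 2 * ((swept_angle p x - swept_angle p 1) / (x - 1)) / (1 + x)) \<longlongrightarrow> 2 * r / (1 + 1))
      (at_left 1)"
    by (intro tendsto_intros) auto
  moreover have "\<forall>\<^sub>F x in at_left 1. 2 * ((swept_angle p x - swept_angle p 1) / (x - 1)) / (1 + x)
      = \<Theta> x / (1 - x\<^sup>2)"
  proof -
    have "\<forall>\<^sub>F x in at_left (1::real). x \<in> {0<..<1}" by (rule eventually_at_leftI[of 0]) auto
    then show ?thesis
    proof eventually_elim
      case (elim x)
      have "1 - x\<^sup>2 = (1 - x) * (1 + x)" by (simp add: power2_eq_square algebra_simps)
      then show ?case using elim swept_angle_1[OF p]
        by (simp add: \<Theta>_def divide_simps) (simp add: algebra_simps)
    qed
  qed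
  ultimately have ratio: "((\<lambda>x. \<Theta> x / (1 - x\<^sup>2)) \<longlongrightarrow> r) (at_left 1)"
    by (simp add: tendsto_cong)
  have rate: "(swept_rate p \<longlongrightarrow> r) (at_left 1)"
    using continuous_on_swept_rate[OF p] unfolding continuous_on_def at1[symmetric] r_def by simp
  have "(swept_angle p \<longlongrightarrow> swept_angle p 1) (at_left 1)"
    using continuous_on_swept_angle[OF p] unfolding continuous_on_def at1[symmetric] by simp
  then have dev: "(\<Theta> \<longlongrightarrow> 0) (at_left 1)"
    unfolding \<Theta>_def swept_angle_1[OF p] by (auto intro!: tendsto_eq_intros)
  define W where "W x = 2 powr (4 / p) * (\<Theta> x / (1 - x\<^sup>2)) powr (2 / p) *
     (\<Theta> x + 2 * x\<^sup>2 / p * (\<Theta> x / (1 - x\<^sup>2))) * x / (2 * swept_rate p x)" for x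
  have "(W \<longlongrightarrow> 2 powr (4 / p) * r powr (2 / p) * (0 + 2 * 1\<^sup>2 / p * r) * 1 / (2 * r)) (at_left 1)"
    unfolding W_def using r p
    by (intro tendsto_intros ratio rate dev) auto
  also have "2 powr (4 / p) * r powr (2 / p) * (0 + 2 * 1\<^sup>2 / p * r) * 1 / (2 * r) = grazing_constant s"
    using r p by (simp add: grazing_constant_def r_def swept_rate_1 p_def)
  finally have "(W \<longlongrightarrow> grazing_constant s) (at_left 1)" .
  from filterlim_compose[OF this turning_at_tendsto_1]
  have "((\<lambda>\<theta>. W (turning_at s \<theta>)) \<longlongrightarrow> grazing_constant s) (at_right 0)" .
  moreover have "\<forall>\<^sub>F \<theta> in at_right 0. W (turning_at s \<theta>) =
      \<theta> powr (1 + 2 / p) * angular_kernel s (cos \<theta>) * sin \<theta>"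
  proof -
    have "\<forall>\<^sub>F \<theta> in at_right 0. \<theta> \<in> {0<..<pi}" by (rule eventually_at_rightI[of _ pi]) auto
    then show ?thesis
    proof eventually_elim
      case (elim \<theta>)
      then have \<theta>: "0 < \<theta>" "\<theta> < pi" by auto
      show ?case
        using turning_at(3)[OF \<theta>] unfolding weighted_kernel_eq[OF \<theta>] by (simp add: W_def \<Theta>_def)
    qed
  qed
  ultimately show ?thesis by (simp add: tendsto_cong)
qed

text \<open>The quotient \<open>0/0\<close> is resolved by the derivative of \<open>sin (2 F(x))\<close> at \<open>x = 0\<close>, which is \<open>2 G(0) > 0\<close>.
  The limit must exist for the value of the kernel at \<open>\<theta> = \<pi>\<close> to be meaningful.\<close>

lemma kernel_formula_convergent_at_pi: "\<exists>l. (kernel_formula s \<longlongrightarrow> l) (at_left pi)"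
proof -
  have p: "p \<ge> 1" by (rule exponent_ge_1)
  define r where "r = swept_rate p 0"
  have r: "r \<ge> 1/2" using swept_rate_bounds(1)[OF p, of 0] by (simp add: r_def)
  have at0: "at 0 within {0..1} = at_right (0::real)" by (simp add: at_within_Icc_at_right)
  have "((\<lambda>x. sin (2 * swept_angle p x)) has_real_derivative cos (2 * swept_angle p 0) * (2 * r))
      (at 0 within {0..1})"
    unfolding r_def by (intro DERIV_chain2[OF DERIV_sin] DERIV_cmult swept_angle_deriv[OF p]) auto
  then have S: "((\<lambda>x. sin (2 * swept_angle p x) / x) \<longlongrightarrow> 2 * r) (at_right 0)"
    unfolding has_field_derivative_iff at0 by (simp add: swept_angle_0[OF p])
  have rate: "(swept_rate p \<longlongrightarrow> r) (at_right 0)"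
    using continuous_on_swept_rate[OF p] unfolding continuous_on_def at0[symmetric] r_def by simp
  define W where "W x = 2 powr (4 / p) * ((1 - x\<^sup>2) powr (- (2 / p)) * (1 + 2 * x\<^sup>2 / (p * (1 - x\<^sup>2))))
      / (2 * swept_rate p x * (sin (2 * swept_angle p x) / x))" for x
  have "(W \<longlongrightarrow> 2 powr (4 / p) * ((1 - 0\<^sup>2) powr (- (2 / p)) * (1 + 2 * 0\<^sup>2 / (p * (1 - 0\<^sup>2))))
      / (2 * r * (2 * r))) (at_right 0)"
    unfolding W_def using r p by (intro tendsto_intros rate S) auto
  from filterlim_compose[OF this turning_at_tendsto_0]
  obtain l where "((\<lambda>\<theta>. W (turning_at s \<theta>)) \<longlongrightarrow> l) (at_left pi)" by blast
  moreover have "\<forall>\<^sub>F \<theta> in at_left pi. W (turning_at s \<theta>) = kernel_formula s \<theta>"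
  proof -
    have "\<forall>\<^sub>F \<theta> in at_left pi. \<theta> \<in> {0<..<pi}" by (rule eventually_at_leftI[of 0]) auto
    then show ?thesis
    proof eventually_elim
      case (elim \<theta>)
      then have \<theta>: "0 < \<theta>" "\<theta> < pi" by auto
      note x = turning_at(1-3)[OF \<theta>]
      have "W (turning_at s \<theta>) = kernel_formula s (pi - 2 * swept_angle p (turning_at s \<theta>))"
        unfolding p_def kernel_formula_swept_angle[OF s x(1,2)] using x(1)
        by (simp add: W_def p_def)
      then show ?case using x(3) by simp
    qed
  qed
  ultimately show ?thesis by (auto simp: tendsto_cong)
qed

end

section \<open>Comparison with rigid spheres\<close>

lemma sin_cos_diff_le:
  fixes a b :: real
  shows "\<bar>sin a - sin b\<bar> \<le> \<bar>a - b\<bar>" "\<bar>cos a - cos b\<bar> \<le> \<bar>a - b\<bar>"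
  using field_differentiable_bound[of UNIV sin cos 1 a b]
    field_differentiable_bound[of UNIV cos "\<lambda>x. - sin x" 1 a b]
  by (auto intro!: derivative_eq_intros)

lemma rigid_square_pos:
  fixes x z :: real
  assumes "0 \<le> x" "x < 1" "z \<in> {0..1}"
  shows "1 - x\<^sup>2 \<le> 1 - x\<^sup>2 * z\<^sup>2" "0 < 1 - x\<^sup>2"
  using assms abs_square_less_1[of x] by (auto simp: mult_left_le power_le_one)

text \<open>For rigid spheres the counterparts of \<open>F\<close> and \<open>G\<close> are explicit: \<open>arcsin x\<close> and its derivative.\<close>

lemma rigid_integrals:
  fixes x :: real
  assumes x: "0 \<le> x" "x < 1"
  shows "set_integrable lborel {0<..<1} (\<lambda>z. x / sqrt (1 - x\<^sup>2 * z\<^sup>2))"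
    "(LBINT z:{0<..<1}. x / sqrt (1 - x\<^sup>2 * z\<^sup>2)) = arcsin x"
    "set_integrable lborel {0<..<1} (\<lambda>z. 1 / ((1 - x\<^sup>2 * z\<^sup>2) * sqrt (1 - x\<^sup>2 * z\<^sup>2)))"
    "(LBINT z:{0<..<1}. 1 / ((1 - x\<^sup>2 * z\<^sup>2) * sqrt (1 - x\<^sup>2 * z\<^sup>2))) = 1 / sqrt (1 - x\<^sup>2)"
proof -
  have E: "1 - x\<^sup>2 * z\<^sup>2 > 0" if "z \<in> {0..1}" for z using rigid_square_pos[OF x that] by linarith
  have S: "sqrt (1 - x\<^sup>2 * z\<^sup>2) \<noteq> 0"
    and T: "(1 - x\<^sup>2 * z\<^sup>2) * sqrt (1 - x\<^sup>2 * z\<^sup>2) \<noteq> 0" if "z \<in> {0..1}" for z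
    using E[OF that] by (metis less_irrefl real_sqrt_gt_zero, metis less_irrefl real_sqrt_gt_zero mult_pos_pos)
  have xz: "x * z < 1" "0 \<le> x * z" if "z \<in> {0..1}" for z
    using x that mult_mono[of x x z 1] by auto
  have d1: "((\<lambda>z. arcsin (x * z)) has_real_derivative x / sqrt (1 - x\<^sup>2 * z\<^sup>2)) (at z)"
    if "z \<in> {0<..<1}" for z
  proof -
    have "((\<lambda>z. arcsin (x * z)) has_real_derivative inverse (sqrt (1 - (x * z)\<^sup>2)) * x) (at z)"
      using xz[of z] that by (intro DERIV_chain2[OF DERIV_arcsin]) (auto intro!: derivative_eq_intros)
    then show ?thesis by (simp add: power_mult_distrib field_simps)
  qed
  have c1: "continuous_on {0<..<1} (\<lambda>z. x / sqrt (1 - x\<^sup>2 * z\<^sup>2))"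
    by (intro continuous_intros ballI S) auto
  have n1: "\<forall>z\<in>{0<..<1}. 0 \<le> x / sqrt (1 - x\<^sup>2 * z\<^sup>2)"
    using x E by (auto intro!: divide_nonneg_nonneg simp: less_imp_le)
  have C1: "continuous_on {0..1} (\<lambda>z. arcsin (x * z))"
    using xz by (intro continuous_intros) (force intro: less_imp_le)+
  show "set_integrable lborel {0<..<1} (\<lambda>z. x / sqrt (1 - x\<^sup>2 * z\<^sup>2))"
    "(LBINT z:{0<..<1}. x / sqrt (1 - x\<^sup>2 * z\<^sup>2)) = arcsin x"
    using unit_interval_FTC_closed[OF d1 c1 _ C1] n1 by auto
  have d2: "((\<lambda>z. z / sqrt (1 - x\<^sup>2 * z\<^sup>2)) has_real_derivative
      1 / ((1 - x\<^sup>2 * z\<^sup>2) * sqrt (1 - x\<^sup>2 * z\<^sup>2))) (at z)" if z: "z \<in> {0<..<1}" for z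
  proof -
    define r where "r = sqrt (1 - x\<^sup>2 * z\<^sup>2)"
    have t: "1 - x\<^sup>2 * z\<^sup>2 > 0" using E[of z] z by simp
    have r: "r > 0" "r * r = 1 - x\<^sup>2 * z\<^sup>2" using t by (simp_all add: r_def)
    have "((\<lambda>z. z / sqrt (1 - x\<^sup>2 * z\<^sup>2)) has_real_derivative
        (1 * r - z * (- (2 * x\<^sup>2 * z) * (inverse r / 2))) / (r * r)) (at z)"
      unfolding r_def using t by (auto intro!: derivative_eq_intros)
    also have "(1 * r - z * (- (2 * x\<^sup>2 * z) * (inverse r / 2))) / (r * r)
        = (r * r + x\<^sup>2 * z\<^sup>2) / ((r * r) * r)"
      using r(1) by (simp add: field_simps power2_eq_square)
    also have "\<dots> = 1 / ((1 - x\<^sup>2 * z\<^sup>2) * sqrt (1 - x\<^sup>2 * z\<^sup>2))"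
      unfolding r(2) by (simp add: r_def)
    finally show ?thesis .
  qed
  have c2: "continuous_on {0<..<1} (\<lambda>z. 1 / ((1 - x\<^sup>2 * z\<^sup>2) * sqrt (1 - x\<^sup>2 * z\<^sup>2)))"
    by (intro continuous_intros ballI T) auto
  have n2: "\<forall>z\<in>{0<..<1}. 0 \<le> 1 / ((1 - x\<^sup>2 * z\<^sup>2) * sqrt (1 - x\<^sup>2 * z\<^sup>2))"
    using E by (auto intro!: divide_nonneg_nonneg mult_nonneg_nonneg simp: less_imp_le)
  have C2: "continuous_on {0..1} (\<lambda>z. z / sqrt (1 - x\<^sup>2 * z\<^sup>2))"
    by (intro continuous_intros ballI S) auto
  show "set_integrable lborel {0<..<1} (\<lambda>z. 1 / ((1 - x\<^sup>2 * z\<^sup>2) * sqrt (1 - x\<^sup>2 * z\<^sup>2)))"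
    "(LBINT z:{0<..<1}. 1 / ((1 - x\<^sup>2 * z\<^sup>2) * sqrt (1 - x\<^sup>2 * z\<^sup>2))) = 1 / sqrt (1 - x\<^sup>2)"
    using unit_interval_FTC_closed[OF d2 c2 _ C2] n2 by auto
qed

text \<open>Here \<open>a\<^sup>2 = 1 - x\<^sup>2z\<^sup>2\<close> is the radicand for rigid spheres, \<open>b\<^sup>2\<close> the actual radicand,
  \<open>t = 1 - x\<^sup>2\<close>, \<open>w = z\<^sup>p\<close> and \<open>c\<^sup>2 = 1 - z\<close>. The difference of the radicands carries the factor
  \<open>t\<close>, which cancels one power of \<open>a\<^sup>2 \<ge> t\<close>; hence the bound does not deteriorate as \<open>t \<rightarrow> 0\<close>.\<close>

lemma rigid_comparison:
  fixes a b t w c :: real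
  assumes b: "0 < b" "b \<le> a" and t: "0 < t" "t \<le> a\<^sup>2" and diff: "a\<^sup>2 - b\<^sup>2 = t * w" and w: "0 \<le> w"
    and c: "0 < c" "c \<le> b"
  shows "0 \<le> 1 / b - 1 / a" "1 / b - 1 / a \<le> w / c"
proof -
  have a: "a > 0" using b by simp
  show "0 \<le> 1 / b - 1 / a" using b by (simp add: frac_le)
  have "1 / b - 1 / a = (a\<^sup>2 - b\<^sup>2) / ((a + b) * a * b)"
    using a b by (simp add: divide_simps) (simp add: algebra_simps power2_eq_square)
  also have "\<dots> \<le> (a\<^sup>2 * w) / (a * a * b)"
    unfolding diff using a b t w by (intro frac_le mult_right_mono mult_nonneg_nonneg) auto
  also have "\<dots> = w / b" using a by (simp add: power2_eq_square)
  also have "\<dots> \<le> w / c" using c w by (intro divide_left_mono mult_pos_pos) auto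
  finally show "1 / b - 1 / a \<le> w / c" .
qed

text \<open>The same comparison for the integrands of the derivative. The singularity of \<open>b\<^sup>-\<^sup>3\<close> at \<open>z = 1\<close> is
  reduced by the numerator through \<open>t (1 - w) \<le> b\<^sup>2\<close>, so that the bound is again a multiple of
  \<open>w / c = z\<^sup>p (1 - z)\<^sup>-\<^sup>1\<^sup>/\<^sup>2\<close>; the price is a negative power of \<open>t\<close>.\<close>

lemma rigid_comparison_cubed:
  fixes a b t w c :: real
  assumes b: "0 < b" "b \<le> a" and t: "0 < t" "t \<le> a\<^sup>2" and diff: "a\<^sup>2 - b\<^sup>2 = t * w"
    and w: "0 \<le> w" "w < 1" and c: "0 < c" "c \<le> 1" "c\<^sup>2 \<le> 1 - w" and bB: "t * (1 - w) \<le> b\<^sup>2"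
  shows "\<bar>(1 - w) / b ^ 3 - 1 / a ^ 3\<bar> \<le> 4 * (w / c) / (t * sqrt t)"
proof -
  have a: "a > 0" using b by simp
  have st: "sqrt t > 0" using t by simp
  have sta: "sqrt t \<le> a" using t a by (simp add: real_le_lsqrt)
  have stb: "sqrt t * c \<le> b"
  proof -
    have "(sqrt t * c)\<^sup>2 = t * c\<^sup>2" using t by (simp add: power_mult_distrib)
    also have "\<dots> \<le> b\<^sup>2" using c(3) t bB by (meson mult_left_mono less_imp_le order_trans)
    finally show ?thesis using b power2_le_imp_le by (metis less_imp_le)
  qed
  define u where "u = w / c / (t * sqrt t)"
  have u0: "u \<ge> 0" using w c t by (simp add: u_def)
  have eq: "(1 - w) / b ^ 3 - 1 / a ^ 3 = (1 - w) * (a ^ 3 - b ^ 3) / (a ^ 3 * b ^ 3) - w / a ^ 3"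
    using a b by (simp add: divide_simps) (simp add: algebra_simps)
  have "w / a ^ 3 \<le> w / (t * sqrt t * c)"
  proof -
    have "t * sqrt t * c \<le> a ^ 3" unfolding power3_eq_cube power2_eq_square[symmetric]
      using mult_mono[of "t * sqrt t" "a\<^sup>2 * a" c 1] mult_mono[of t "a\<^sup>2" "sqrt t" a] t sta c a
      by (simp add: power2_eq_square)
    then show ?thesis using w t c by (intro divide_left_mono) (auto intro!: mult_pos_pos zero_less_power a)
  qed
  then have second: "0 \<le> w / a ^ 3" "w / a ^ 3 \<le> u" using w a by (auto simp: u_def mult_ac)
  have "a ^ 3 - b ^ 3 = (a - b) * (a\<^sup>2 + a * b + b\<^sup>2)"
    by (simp add: power2_eq_square power3_eq_cube algebra_simps)
  also have "\<dots> \<le> (a - b) * (3 * a * (a + b))"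
  proof (rule mult_left_mono)
    have "b * b \<le> a * b" using b by (intro mult_right_mono) auto
    moreover have "0 \<le> a * b" "0 \<le> a * a" using a b by auto
    moreover have "3 * a * (a + b) = 3 * (a * a) + 3 * (a * b)" by (simp add: algebra_simps)
    ultimately show "a\<^sup>2 + a * b + b\<^sup>2 \<le> 3 * a * (a + b)"
      unfolding power2_eq_square by linarith
  qed (use b in simp)
  also have "\<dots> = 3 * a * (t * w)" unfolding diff[symmetric]
    by (simp add: power2_eq_square algebra_simps)
  finally have cub: "a ^ 3 - b ^ 3 \<le> 3 * a * (t * w)" .
  have cub0: "b ^ 3 \<le> a ^ 3" using b by (intro power_mono) auto
  have "(1 - w) * (a ^ 3 - b ^ 3) / (a ^ 3 * b ^ 3) \<le> (1 - w) * (3 * a * (t * w)) / (a ^ 3 * b ^ 3)"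
    using cub w a b by (intro divide_right_mono mult_left_mono) auto
  also have "\<dots> = 3 * (t * (1 - w)) * w / (a\<^sup>2 * b ^ 3)"
    using a by (simp add: power2_eq_square power3_eq_cube mult_ac)
  also have "\<dots> \<le> 3 * b\<^sup>2 * w / (t * b ^ 3)"
    using bB t a b w by (intro frac_le mult_mono mult_right_mono) auto
  also have "\<dots> = 3 * w / (t * b)" using b by (simp add: power2_eq_square power3_eq_cube)
  also have "\<dots> \<le> 3 * w / (t * (sqrt t * c))"
    using stb t st w c b by (intro divide_left_mono mult_left_mono mult_pos_pos) auto
  also have "\<dots> = 3 * u" by (simp add: u_def mult_ac)
  finally have first: "(1 - w) * (a ^ 3 - b ^ 3) / (a ^ 3 * b ^ 3) \<le> 3 * u" .
  have first0: "0 \<le> (1 - w) * (a ^ 3 - b ^ 3) / (a ^ 3 * b ^ 3)"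
    using cub0 w a b by (intro divide_nonneg_nonneg mult_nonneg_nonneg) auto
  have "\<bar>(1 - w) / b ^ 3 - 1 / a ^ 3\<bar> \<le> 4 * u"
    unfolding eq using first first0 second u0 by (intro abs_leI) linarith+
  then show ?thesis by (simp add: u_def)
qed

context
  fixes p x :: real
  assumes p: "p \<ge> 1" and x: "0 \<le> x" "x < 1"
begin

text \<open>The factor \<open>x\<close> in the upper bound is what makes the estimate strong enough at head-on collisions,
  where \<open>x / sin F(x)\<close> has to be close to \<open>1\<close>.\<close>

lemma swept_angle_vs_arcsin:
  "0 \<le> swept_angle p x - arcsin x" "swept_angle p x - arcsin x \<le> x * tail_moment p"
proof -
  have x': "x \<in> {0..1}" using x by auto
  have diff: "swept_angle p x - arcsin x =
      (LBINT z:{0<..<1}. x / sqrt (radicand p x z) - x / sqrt (1 - x\<^sup>2 * z\<^sup>2))"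
    unfolding swept_angle_def rigid_integrals(2)[OF x, symmetric]
    by (rule set_integral_diff(2)[symmetric, OF angle_integrand_integrable[OF p x'] rigid_integrals(1)[OF x]])
  have int: "set_integrable lborel {0<..<1} (\<lambda>z. x / sqrt (radicand p x z) - x / sqrt (1 - x\<^sup>2 * z\<^sup>2))"
    by (intro set_integral_diff(1) angle_integrand_integrable[OF p x'] rigid_integrals(1)[OF x])
  have int2: "set_integrable lborel {0<..<1} (\<lambda>z. x * (z powr p / sqrt (1 - z)))"
    using p by (intro set_integrable_mult_right) (auto intro: tail_moment_integrable)
  have bounds: "0 \<le> x / sqrt (radicand p x z) - x / sqrt (1 - x\<^sup>2 * z\<^sup>2) \<and>
      x / sqrt (radicand p x z) - x / sqrt (1 - x\<^sup>2 * z\<^sup>2) \<le> x * (z powr p / sqrt (1 - z))"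
    if z: "z \<in> {0<..<1}" for z
  proof -
    note R = radicand_bounds[OF p x' z]
    have t: "1 - x\<^sup>2 \<le> 1 - x\<^sup>2 * z\<^sup>2" "0 < 1 - x\<^sup>2" using rigid_square_pos[OF x, of z] z by auto
    have D: "0 < radicand p x z" using R z by auto
    have le: "radicand p x z \<le> 1 - x\<^sup>2 * z\<^sup>2" using t by (simp add: radicand_eq)
    have "0 < sqrt (radicand p x z)" "sqrt (radicand p x z) \<le> sqrt (1 - x\<^sup>2 * z\<^sup>2)"
      "1 - x\<^sup>2 \<le> (sqrt (1 - x\<^sup>2 * z\<^sup>2))\<^sup>2"
      "(sqrt (1 - x\<^sup>2 * z\<^sup>2))\<^sup>2 - (sqrt (radicand p x z))\<^sup>2 = (1 - x\<^sup>2) * z powr p"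
      "0 \<le> z powr p" "0 < sqrt (1 - z)" "sqrt (1 - z) \<le> sqrt (radicand p x z)"
      using D le t R(1) z by (simp_all add: radicand_eq)
    from rigid_comparison[OF this(1,2) t(2) this(3-7)]
    have "0 \<le> 1 / sqrt (radicand p x z) - 1 / sqrt (1 - x\<^sup>2 * z\<^sup>2)"
      "1 / sqrt (radicand p x z) - 1 / sqrt (1 - x\<^sup>2 * z\<^sup>2) \<le> z powr p / sqrt (1 - z)" by auto
    then show ?thesis
      using x mult_left_mono[of 0 "1 / sqrt (radicand p x z) - 1 / sqrt (1 - x\<^sup>2 * z\<^sup>2)" x]
        mult_left_mono[of "1 / sqrt (radicand p x z) - 1 / sqrt (1 - x\<^sup>2 * z\<^sup>2)" "z powr p / sqrt (1 - z)" x]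
      by (simp add: right_diff_distrib)
  qed
  show "0 \<le> swept_angle p x - arcsin x"
    unfolding diff set_lebesgue_integral_def using bounds
    by (intro Bochner_Integration.integral_nonneg) (auto simp: indicator_def)
  have "swept_angle p x - arcsin x \<le> (LBINT z:{0<..<1}. x * (z powr p / sqrt (1 - z)))"
    unfolding diff using bounds by (intro set_integral_mono int int2) auto
  also have "\<dots> = x * tail_moment p" unfolding tail_moment_def by (rule set_integral_mult_right)
  finally show "swept_angle p x - arcsin x \<le> x * tail_moment p" .
qed

text \<open>The singular dependence on \<open>1 - x\<^sup>2\<close> is harmless in the limit \<open>p \<rightarrow> \<infinity>\<close>, because \<open>x\<close> stays away from
  \<open>1\<close> when \<open>\<theta>\<close> stays away from \<open>0\<close>.\<close>

lemma swept_rate_vs_arcsin_rate: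
  "\<bar>swept_rate p x - 1 / sqrt (1 - x\<^sup>2)\<bar> \<le> 4 * tail_moment p / ((1 - x\<^sup>2) * sqrt (1 - x\<^sup>2))"
proof -
  define t where "t = 1 - x\<^sup>2"
  define f where "f z = (1 - z powr p) / (radicand p x z * sqrt (radicand p x z)) -
      1 / ((1 - x\<^sup>2 * z\<^sup>2) * sqrt (1 - x\<^sup>2 * z\<^sup>2))" for z
  define g where "g z = 4 / (t * sqrt t) * (z powr p / sqrt (1 - z))" for z
  have x': "x \<in> {0..1}" using x by auto
  have t0: "t > 0" using rigid_square_pos(2)[OF x, of 0] by (simp add: t_def)
  have diff: "swept_rate p x - 1 / sqrt (1 - x\<^sup>2) = (LBINT z:{0<..<1}. f z)"
    unfolding swept_rate_def rigid_integrals(4)[OF x, symmetric] f_def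
    by (rule set_integral_diff(2)[symmetric, OF rate_integrand_integrable[OF p x'] rigid_integrals(3)[OF x]])
  have int: "set_integrable lborel {0<..<1} f"
    unfolding f_def by (intro set_integral_diff(1) rate_integrand_integrable[OF p x'] rigid_integrals(3)[OF x])
  have int2: "set_integrable lborel {0<..<1} g"
    unfolding g_def using p by (intro set_integrable_mult_right) (auto intro: tail_moment_integrable)
  have bound: "\<bar>f z\<bar> \<le> g z" if z: "z \<in> {0<..<1}" for z
  proof -
    define a where "a = sqrt (1 - x\<^sup>2 * z\<^sup>2)"
    define b where "b = sqrt (radicand p x z)"
    note R = radicand_bounds[OF p x' z]
    note G = powr_gap_bounds[OF p z]
    have E: "t \<le> 1 - x\<^sup>2 * z\<^sup>2" using rigid_square_pos[OF x, of z] z by (auto simp: t_def)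
    have D: "0 < radicand p x z" using R z by auto
    have le: "radicand p x z \<le> 1 - x\<^sup>2 * z\<^sup>2" using t0 by (simp add: radicand_eq t_def)
    have sq: "a\<^sup>2 = 1 - x\<^sup>2 * z\<^sup>2" "b\<^sup>2 = radicand p x z"
      using E t0 D by (simp_all add: a_def b_def)
    have "f z = (1 - z powr p) / b ^ 3 - 1 / a ^ 3"
      unfolding f_def sq[symmetric] a_def[symmetric] b_def[symmetric] using E t0 D
      by (simp add: power2_eq_square power3_eq_cube a_def b_def)
    also have "\<bar>\<dots>\<bar> \<le> 4 * (z powr p / sqrt (1 - z)) / (t * sqrt t)"
    proof (rule rigid_comparison_cubed)
      show "0 < b" "b \<le> a" using D le by (simp_all add: a_def b_def)
      show "0 < t" "t \<le> a\<^sup>2" using t0 E by (simp_all add: sq)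
      show "a\<^sup>2 - b\<^sup>2 = t * z powr p" by (simp add: sq radicand_eq t_def)
      show "0 \<le> z powr p" "z powr p < 1" using G z by auto
      show "0 < sqrt (1 - z)" "sqrt (1 - z) \<le> 1" "(sqrt (1 - z))\<^sup>2 \<le> 1 - z powr p"
        using z G by auto
      show "t * (1 - z powr p) \<le> b\<^sup>2" using R by (simp add: sq t_def)
    qed
    also have "\<dots> = g z" by (simp add: g_def)
    finally show ?thesis .
  qed
  have up: "(LBINT z:{0<..<1}. f z) \<le> (LBINT z:{0<..<1}. g z)"
    using bound by (intro set_integral_mono int int2) (auto simp: abs_le_iff)
  have int3: "set_integrable lborel {0<..<1} (\<lambda>z. - g z)"
    using set_integrable_mult_right[OF int2, of "- 1"] by simp
  have lo: "(LBINT z:{0<..<1}. - g z) \<le> (LBINT z:{0<..<1}. f z)"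
    using bound by (intro set_integral_mono int int3) (force simp: abs_le_iff)
  have neg: "(LBINT z:{0<..<1}. - g z) = - (LBINT z:{0<..<1}. g z)"
    by (rule set_integral_uminus[OF int2])
  have "(LBINT z:{0<..<1}. g z) = 4 / (t * sqrt t) * tail_moment p"
    unfolding g_def tail_moment_def by (rule set_integral_mult_right)
  with up lo neg show ?thesis unfolding diff unfolding t_def[symmetric] by (simp add: abs_le_iff)
qed

end

section \<open>Uniform convergence and the main result\<close>

text \<open>Products of the lower and of the upper bounds for the six factors in the sandwich below; \<open>c\<close> is a
  lower bound for \<open>sin (\<theta>/2)\<close>.\<close>

definition kernel_lower :: "real \<Rightarrow> real \<Rightarrow> real" where
  "kernel_lower c p = 1 / 4 * (1 / (1 + 4 * tail_moment p / c\<^sup>2)) * (1 / (1 + tail_moment p))"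

definition kernel_upper :: "real \<Rightarrow> real \<Rightarrow> real" where
  "kernel_upper c p = 1 / 4 * 2 powr (4 / p) * (c\<^sup>2) powr (- (2 / p)) * (1 + 2 / (p * c\<^sup>2))
     * (1 / (1 - 4 * tail_moment p / c\<^sup>2)) * (1 + tail_moment p / c)"

lemma tendsto_kernel_bounds:
  assumes c: "c > 0"
  shows "(kernel_lower c \<longlongrightarrow> 1 / 4) at_top" "(kernel_upper c \<longlongrightarrow> 1 / 4) at_top"
proof -
  have "(kernel_lower c \<longlongrightarrow> 1 / 4 * (1 / (1 + 4 * 0 / c\<^sup>2)) * (1 / (1 + 0))) at_top"
    unfolding kernel_lower_def[abs_def] using c by (intro tendsto_intros tail_moment_tendsto_0) auto
  then show "(kernel_lower c \<longlongrightarrow> 1 / 4) at_top" by simp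
  have inv: "((\<lambda>p::real. k / p) \<longlongrightarrow> 0) at_top" for k :: real
    by (rule tendsto_divide_0[OF tendsto_const filterlim_at_top_imp_at_infinity[OF filterlim_ident]])
  have "((\<lambda>p. 2 / c\<^sup>2 / p) \<longlongrightarrow> 0) at_top" by (rule inv)
  then have inv2: "((\<lambda>p. 2 / (p * c\<^sup>2)) \<longlongrightarrow> 0) at_top" by (simp add: mult.commute)
  have "(kernel_upper c \<longlongrightarrow> 1 / 4 * 2 powr 0 * (c\<^sup>2) powr (- 0) * (1 + 0)
     * (1 / (1 - 4 * 0 / c\<^sup>2)) * (1 + 0 / c)) at_top"
    unfolding kernel_upper_def[abs_def] using c
    by (intro tendsto_intros tail_moment_tendsto_0 inv inv2) auto
  then show "(kernel_upper c \<longlongrightarrow> 1 / 4) at_top" using c by simp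
qed

text \<open>With \<open>\<phi> = F(x)\<close> and \<open>sin (2\<phi>) = 2 sin \<phi> cos \<phi>\<close> the kernel is
  \<open>1/4 \<cdot> 2\<^sup>4\<^sup>/\<^sup>p \<cdot> t\<^sup>-\<^sup>2\<^sup>/\<^sup>p \<cdot> (1 + 2x\<^sup>2/(pt)) \<cdot> 1/(\<surd>t G) \<cdot> x / sin \<phi> \<cdot> \<surd>t / cos \<phi>\<close>. For
  \<open>\<theta> \<ge> \<epsilon>\<close> the turning point stays away from \<open>1\<close>, because \<open>\<surd>t \<ge> cos \<phi> = sin (\<theta>/2)\<close>, and this
  makes all six estimates uniform.\<close>

lemma kernel_formula_sandwich:
  fixes s \<epsilon> \<theta> :: real
  assumes s: "s \<ge> 2" and \<epsilon>: "0 < \<epsilon>" and \<theta>: "\<epsilon> \<le> \<theta>" "\<theta> < pi"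
  defines "p \<equiv> s - 1" and "c \<equiv> sin (\<epsilon> / 2)"
  assumes small: "4 * tail_moment p / c\<^sup>2 < 1"
  shows "kernel_lower c p \<le> kernel_formula s \<theta>" "kernel_formula s \<theta> \<le> kernel_upper c p"
proof -
  define \<delta> where "\<delta> = tail_moment p"
  define \<eta> where "\<eta> = 4 * \<delta> / c\<^sup>2"
  define x where "x = turning_at s \<theta>"
  define t where "t = 1 - x\<^sup>2"
  define \<phi> where "\<phi> = swept_angle p x"
  define r where "r = swept_rate p x"
  have \<theta>0: "0 < \<theta>" using \<epsilon> \<theta> by simp
  note x = turning_at(1-3)[OF s \<theta>0 \<theta>(2), folded x_def p_def]
  have p: "p \<ge> 1" using s by (simp add: p_def)
  have \<delta>: "\<delta> \<ge> 0" using tail_moment_nonneg by (simp add: \<delta>_def)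
  have c: "c > 0" unfolding c_def using \<epsilon> \<theta> by (intro sin_gt_zero) auto
  have t: "t > 0" "t \<le> 1" using one_minus_square_ge[OF x(1,2)] x by (simp_all add: t_def)
  have \<phi>: "0 < \<phi>" "\<phi> < pi / 2" "\<theta> = pi - 2 * \<phi>"
    using swept_angle_range[OF p x(1,2)] x(3) by (simp_all add: \<phi>_def)
  have r: "r > 0" using swept_rate_bounds(1)[OF p, of x] x by (simp add: r_def)
  \<comment> \<open>\<open>\<phi>\<close> is close to \<open>arcsin x\<close>, hence \<open>sin \<phi>\<close> to \<open>x\<close> and \<open>cos \<phi>\<close> to \<open>\<surd>t\<close>\<close>
  have arc: "0 \<le> \<phi> - arcsin x" "\<phi> - arcsin x \<le> x * \<delta>"
    using swept_angle_vs_arcsin[OF p, of x] x by (simp_all add: \<phi>_def \<delta>_def)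
  have arc0: "0 \<le> arcsin x" "sin (arcsin x) = x" "cos (arcsin x) = sqrt t"
    using x by (simp_all add: t_def cos_arcsin arcsin_nonneg)
  have cos_ge: "c \<le> cos \<phi>"
  proof -
    have "\<phi> = pi / 2 - \<theta> / 2" using \<phi>(3) by (simp add: field_simps)
    then have "cos \<phi> = sin (\<theta> / 2)" by (simp add: cos_diff)
    moreover have "c \<le> sin (\<theta> / 2)"
      unfolding c_def using \<epsilon> \<theta> by (intro sin_monotone_2pi_le) auto
    ultimately show ?thesis by simp
  qed
  have cos_le: "cos \<phi> \<le> sqrt t"
    using cos_monotone_0_pi_le[of "arcsin x" \<phi>] arc arc0 \<phi> by auto
  have sin_ge: "x \<le> sin \<phi>"
    using sin_monotone_2pi_le[of "arcsin x" \<phi>] arc arc0 \<phi> by auto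
  have sin_le: "sin \<phi> \<le> x * (1 + \<delta>)"
    using sin_cos_diff_le(1)[of \<phi> "arcsin x"] arc arc0 by (simp add: algebra_simps)
  have "x * \<delta> \<le> \<delta>" using x \<delta> by (simp add: mult_left_le_one_le)
  then have cos_ge': "sqrt t \<le> cos \<phi> + \<delta>"
    using sin_cos_diff_le(2)[of \<phi> "arcsin x"] arc arc0 by simp
  have tc: "c\<^sup>2 \<le> t"
  proof -
    have "c\<^sup>2 \<le> (sqrt t)\<^sup>2" using c cos_ge cos_le by (intro power_mono) auto
    then show ?thesis using t by simp
  qed
  have rate: "\<bar>sqrt t * r - 1\<bar> \<le> \<eta>"
  proof -
    have "\<bar>sqrt t * r - 1\<bar> = sqrt t * \<bar>r - 1 / sqrt t\<bar>"
      using t by (simp add: abs_mult_pos' right_diff_distrib)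
    also have "\<dots> \<le> sqrt t * (4 * \<delta> / (t * sqrt t))"
      using swept_rate_vs_arcsin_rate[OF p, of x] x t
      by (intro mult_left_mono) (auto simp: r_def t_def \<delta>_def)
    also have "\<dots> = 4 * \<delta> / t" using t by simp
    also have "\<dots> \<le> \<eta>" unfolding \<eta>_def using tc \<delta> c t by (intro divide_left_mono) auto
    finally show ?thesis .
  qed
  have \<eta>: "\<eta> < 1" "0 \<le> \<eta>" using small \<delta> by (simp_all add: \<eta>_def \<delta>_def)

  define f1 where "f1 = 2 powr (4 / p)"
  define f2 where "f2 = t powr (- (2 / p))"
  define f3 where "f3 = 1 + 2 * x\<^sup>2 / (p * t)"
  define f4 where "f4 = 1 / (sqrt t * r)"
  define f5 where "f5 = x / sin \<phi>"
  define f6 where "f6 = sqrt t / cos \<phi>"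
  have f1: "1 \<le> f1" unfolding f1_def using p by (intro ge_one_powr_ge_zero) auto
  have f2: "1 \<le> f2" "f2 \<le> (c\<^sup>2) powr (- (2 / p))"
  proof -
    have "1 powr (- (2 / p)) \<le> f2" unfolding f2_def using t p by (intro powr_mono2') auto
    then show "1 \<le> f2" by simp
    show "f2 \<le> (c\<^sup>2) powr (- (2 / p))" unfolding f2_def using tc c p by (intro powr_mono2') auto
  qed
  have f3: "1 \<le> f3" "f3 \<le> 1 + 2 / (p * c\<^sup>2)"
  proof -
    show "1 \<le> f3" unfolding f3_def using p t by simp
    have "x\<^sup>2 \<le> 1" using x by (simp add: power_le_one)
    then have "2 * x\<^sup>2 / (p * t) \<le> 2 / (p * c\<^sup>2)"
      using tc c p by (intro frac_le mult_left_mono) auto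
    then show "f3 \<le> 1 + 2 / (p * c\<^sup>2)" by (simp add: f3_def)
  qed
  have f4: "1 / (1 + \<eta>) \<le> f4" "f4 \<le> 1 / (1 - \<eta>)"
    unfolding f4_def using rate \<eta> t r by (auto intro!: divide_left_mono mult_pos_pos simp: abs_le_iff)
  have f5: "1 / (1 + \<delta>) \<le> f5" "f5 \<le> 1"
    unfolding f5_def using sin_ge sin_le x \<delta> by (auto simp: divide_simps mult.commute)
  have f6: "1 \<le> f6" "f6 \<le> 1 + \<delta> / c"
  proof -
    show "1 \<le> f6" unfolding f6_def using cos_le cos_ge c by simp
    have "f6 \<le> (cos \<phi> + \<delta>) / cos \<phi>" unfolding f6_def using cos_ge cos_ge' c
      by (intro divide_right_mono) auto
    also have "\<dots> = 1 + \<delta> / cos \<phi>" using cos_ge c by (simp add: add_divide_distrib)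
    also have "\<dots> \<le> 1 + \<delta> / c" using cos_ge c \<delta> by (intro add_left_mono divide_left_mono) auto
    finally show "f6 \<le> 1 + \<delta> / c" .
  qed
  have "kernel_formula s \<theta> = f1 * (x * f2 * f3) / (2 * r * sin (2 * \<phi>))"
    using kernel_formula_swept_angle[OF s x(1,2), folded p_def]
    unfolding f1_def f2_def f3_def t_def r_def \<phi>_def x(3)[symmetric] .
  also have "\<dots> = 1 / 4 * f1 * f2 * f3 * f4 * f5 * f6"
    using t r unfolding f4_def f5_def f6_def sin_double by (simp add: mult_ac)
  finally have eq: "kernel_formula s \<theta> = 1 / 4 * f1 * f2 * f3 * f4 * f5 * f6" .
  have f40: "0 \<le> f4" "0 \<le> f5" using t r x sin_ge by (auto simp: f4_def f5_def)
  have "1 / 4 * 1 * 1 * 1 * (1 / (1 + \<eta>)) * (1 / (1 + \<delta>)) * 1 \<le> 1 / 4 * f1 * f2 * f3 * f4 * f5 * f6"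
    using f1 f2 f3 f4 f40 f5 f6 \<eta> \<delta> by (intro mult_mono) (auto intro!: mult_nonneg_nonneg)
  then show "kernel_lower c p \<le> kernel_formula s \<theta>"
    unfolding eq kernel_lower_def by (simp add: \<eta>_def \<delta>_def)
  have "1 / 4 * f1 * f2 * f3 * f4 * f5 * f6 \<le> 1 / 4 * f1 * (c\<^sup>2) powr (- (2 / p)) * (1 + 2 / (p * c\<^sup>2))
     * (1 / (1 - \<eta>)) * 1 * (1 + \<delta> / c)"
    using f1 f2 f3 f4 f40 f5 f6 \<eta> \<delta> p by (intro mult_mono) (auto intro!: mult_nonneg_nonneg)
  then show "kernel_formula s \<theta> \<le> kernel_upper c p"
    unfolding eq kernel_upper_def by (simp add: \<eta>_def \<delta>_def f1_def)
qed

text \<open>The bounds do not depend on \<open>\<theta>\<close>, so they pass to the limit \<open>\<theta> \<rightarrow> \<pi>\<close>.\<close>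

lemma angular_kernel_sandwich:
  fixes s \<epsilon> \<theta> :: real
  assumes s: "s \<ge> 2" and \<epsilon>: "0 < \<epsilon>" "\<epsilon> < pi" and \<theta>: "\<epsilon> \<le> \<theta>" "\<theta> \<le> pi"
  defines "p \<equiv> s - 1" and "c \<equiv> sin (\<epsilon> / 2)"
  assumes small: "4 * tail_moment p / c\<^sup>2 < 1"
  shows "angular_kernel s (cos \<theta>) \<in> {kernel_lower c p..kernel_upper c p}"
proof (cases "\<theta> = pi")
  case False
  then show ?thesis
    using kernel_formula_sandwich[OF s \<epsilon>(1) \<theta>(1)] small \<theta> \<epsilon>
    by (simp add: angular_kernel_cos p_def c_def)
next
  case True
  obtain l where l: "(kernel_formula s \<longlongrightarrow> l) (at_left pi)"
    using kernel_formula_convergent_at_pi[OF s] by blast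
  then have "angular_kernel s (cos \<theta>) = l"
    using True by (simp add: angular_kernel_def tendsto_Lim)
  moreover have ev: "\<forall>\<^sub>F \<theta> in at_left pi. \<theta> \<in> {\<epsilon><..<pi}"
    using \<epsilon> by (intro eventually_at_leftI[of \<epsilon>]) auto
  have "kernel_lower c p \<le> l"
    by (rule tendsto_lowerbound[OF l eventually_mono[OF ev]])
      (use kernel_formula_sandwich(1)[OF s \<epsilon>(1)] small in \<open>auto simp: p_def c_def\<close>)
  moreover have "l \<le> kernel_upper c p"
    by (rule tendsto_upperbound[OF l eventually_mono[OF ev]])
      (use kernel_formula_sandwich(2)[OF s \<epsilon>(1)] small in \<open>auto simp: p_def c_def\<close>)
  ultimately show ?thesis by simp
qed

lemma angular_kernel_uniform_limit:
  assumes K: "compact K" "K \<subseteq> {0<..pi}"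
  shows "uniform_limit K (\<lambda>s \<theta>. angular_kernel s (cos \<theta>)) (\<lambda>\<theta>. 1 / 4) at_top"
proof (cases "K = {}")
  case False
  obtain m where m: "m \<in> K" "\<And>\<theta>. \<theta> \<in> K \<Longrightarrow> m \<le> \<theta>"
    using compact_attains_inf[OF K(1) False] by blast
  define \<epsilon> where "\<epsilon> = min m 1"
  have \<epsilon>: "0 < \<epsilon>" "\<epsilon> < pi" "\<epsilon> \<le> m" using m K pi_gt3 by (auto simp: \<epsilon>_def)
  define c where "c = sin (\<epsilon> / 2)"
  have c: "c > 0" unfolding c_def using \<epsilon> by (intro sin_gt_zero) auto
  have shift: "filterlim (\<lambda>s::real. s - 1) at_top at_top"
    using filterlim_tendsto_add_at_top[OF tendsto_const[of "- 1::real"] filterlim_ident] by simp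
  show ?thesis
  proof (rule uniform_limitI)
    fix e :: real assume e: "e > 0"
    have "((\<lambda>p. 4 * tail_moment p / c\<^sup>2) \<longlongrightarrow> 4 * 0 / c\<^sup>2) at_top"
      using c by (intro tendsto_intros tail_moment_tendsto_0) auto
    then have "\<forall>\<^sub>F p in at_top. 4 * tail_moment p / c\<^sup>2 < 1" by (rule order_tendstoD) simp
    moreover have "\<forall>\<^sub>F p in at_top. 1 / 4 - e < kernel_lower c p"
      by (rule order_tendstoD(1)[OF tendsto_kernel_bounds(1)[OF c]]) (use e in simp)
    moreover have "\<forall>\<^sub>F p in at_top. kernel_upper c p < 1 / 4 + e"
      by (rule order_tendstoD(2)[OF tendsto_kernel_bounds(2)[OF c]]) (use e in simp)
    ultimately have "\<forall>\<^sub>F p in at_top. 4 * tail_moment p / c\<^sup>2 < 1 \<and>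
        1 / 4 - e < kernel_lower c p \<and> kernel_upper c p < 1 / 4 + e"
      by eventually_elim simp
    from eventually_compose_filterlim[OF this shift] eventually_ge_at_top[of 2]
    show "\<forall>\<^sub>F s in at_top. \<forall>\<theta>\<in>K. dist (angular_kernel s (cos \<theta>)) (1 / 4) < e"
    proof eventually_elim
      case (elim s)
      show ?case
      proof
        fix \<theta> assume "\<theta> \<in> K"
        then have "\<epsilon> \<le> \<theta>" "\<theta> \<le> pi" using m(2)[of \<theta>] \<epsilon> K by auto
        from angular_kernel_sandwich[OF elim(2) \<epsilon>(1,2) this] elim(1)
        show "dist (angular_kernel s (cos \<theta>)) (1 / 4) < e"
          by (auto simp: dist_real_def c_def)
      qed
    qed
  qed
qed simp

theorem theorem1:
  shows
    "(\<forall>K. compact K \<and> K \<subseteq> {0<..pi} \<longrightarrow>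
       uniform_limit K (\<lambda>s \<theta>. angular_kernel s (cos \<theta>)) (\<lambda>\<theta>. 1 / 4) at_top)
     \<and> (\<forall>s\<ge>2. ((\<lambda>\<theta>. \<theta> powr (1 + 2 / (s - 1)) * angular_kernel s (cos \<theta>) * sin \<theta>)
          \<longlongrightarrow> grazing_constant s) (at_right 0))
     \<and> (SUP s\<in>{3..}. SUP \<theta>\<in>{0<..pi}.
          ereal (\<theta> powr (1 + 2 / (s - 1)) * angular_kernel s (cos \<theta>) * sin \<theta>)) < \<infinity>"
proof (intro conjI allI impI)
  fix K :: "real set" assume "compact K \<and> K \<subseteq> {0<..pi}"
  then show "uniform_limit K (\<lambda>s \<theta>. angular_kernel s (cos \<theta>)) (\<lambda>\<theta>. 1 / 4) at_top"
    using angular_kernel_uniform_limit by blast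
next
  fix s :: real assume "s \<ge> 2"
  then show "((\<lambda>\<theta>. \<theta> powr (1 + 2 / (s - 1)) * angular_kernel s (cos \<theta>) * sin \<theta>)
          \<longlongrightarrow> grazing_constant s) (at_right 0)"
    by (rule weighted_kernel_limit)
next
  have "(SUP s\<in>{3..}. SUP \<theta>\<in>{0<..pi}.
      ereal (\<theta> powr (1 + 2 / (s - 1)) * angular_kernel s (cos \<theta>) * sin \<theta>)) \<le> ereal (16 * exp 8 * 12)"
  proof (intro SUP_least)
    fix s \<theta> :: real assume s: "s \<in> {3..}" and \<theta>: "\<theta> \<in> {0<..pi}"
    show "ereal (\<theta> powr (1 + 2 / (s - 1)) * angular_kernel s (cos \<theta>) * sin \<theta>) \<le> ereal (16 * exp 8 * 12)"
    proof (cases "\<theta> = pi")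
      case False
      then show ?thesis using weighted_kernel_bound[of s \<theta>] s \<theta> by simp
    qed simp
  qed
  also have "\<dots> < \<infinity>" by simp
  finally show "(SUP s\<in>{3..}. SUP \<theta>\<in>{0<..pi}.
      ereal (\<theta> powr (1 + 2 / (s - 1)) * angular_kernel s (cos \<theta>) * sin \<theta>)) < \<infinity>" .
qed

end
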